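(* Let $V\subseteq\mathcal V$ be finite, $\mathbb E\in\mathit{NProg}(V)$, $W\subseteq\mathcal V$ finite, $P,Q$ projectors on $\mathcal H_W$, and $xp^p\in\{wp^p,wlp^p\}$. Then: (1) $sp^p.\mathbb E.(wlp^p.\mathbb E.Q)\sqsubseteq Q$ and $P\sqsubseteq wlp^p.\mathbb E.(sp^p.\mathbb E.P)$; (2) $wp^p.\mathbb E.Q=wlp^p.\mathbb E.Q\wedge wp^p.\mathbb E.I_W$; (3) $wp^p.\mathbb E.0=sp^p.\mathbb E.0=0$ and $wlp^p.\mathbb E.I_W=I_W$; (4) if $P\sqsubseteq Q$ then $xp^p.\mathbb E.P\sqsubseteq xp^p.\mathbb E.Q$ and $sp^p.\mathbb E.P\sqsubseteq sp^p.\mathbb E.Q$; (5) $xp^p.\mathbb E.(P\wedge Q)=xp^p.\mathbb E.P\wedge xp^p.\mathbb E.Q$; (6) $sp^p.\mathbb E.(P\wedge Q)\sqsubseteq sp^p.\mathbb E.P\wedge sp^p.\mathbb E.Q$; (7) $xp^p.\mathbb E.P\vee xp^p.\mathbb E.Q\sqsubseteq xp^p.\mathbb E.(P\vee Q)$; (8) $sp^p.\mathbb E.P\vee sp^p.\mathbb E.Q=sp^p.\mathbb E.(P\vee Q)$; (9) if $R$ is a projector on $\mathcal H_{W'}$ with $W'$ finite and $W'\cap(V\cup W)=\emptyset$, then $wp^p.\mathbb E.(Q\otimes R)=(wp^p.\mathbb E.Q)\otimes R$, $sp^p.\mathbb E.(P\otimes R)=(sp^p.\mathbb E.P)\otimes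 R$, and $wlp^p.\mathbb E.(Q\otimes R)\sqsupseteq(wlp^p.\mathbb E.Q)\otimes R$.
   Context: $\mathcal V$ is a countably infinite set of qubit variables; $\mathcal H_V=\bigotimes_{q\in V}\mathcal H_q$ with identity $I_V$. $\mathcal D(\mathcal H)$: partial density operators; projectors are identified with their image subspaces, ordered by inclusion $\sqsubseteq$; $\wedge$ intersection, $\vee$ span of union. $\mathit{DProg}(V)$: completely positive trace-nonincreasing super-operators on $\mathcal L(\mathcal H_V)$; $\mathit{NProg}(V)$: nonempty convex closed subsets of $\mathit{DProg}(V)$. Convention: operators/super-operators on subsystems are implicitly extended to larger systems by tensoring with identities; the transformers of a projector on a system $U$ are regarded as projectors on $\mathcal H_{V\cup U}$. For projectors $P,Q$ on $\mathcal H_U$: $\mathbb E\models_{tot}(\{P\},\{Q\})$ iff for all finite $X\supseteq V\cup U$ and $\rho\in\mathcal D(\mathcal H_X)$, ${\rm tr}(P\rho)\le\inf_{\mathcal E\in\mathbb E}{\rm tr}(Q\mathcal E(\rho))$; $\mathbb E\models_{par}(\{P\},\{Q\})$ iff for all such $X,\rho$, ${\rm tr}(P\rho)\le\inf_{\mathcal E\in\mathbb E}[{\rm tr}(Q\mathcal E(\rho))+{\rm tr}(\rho)-{\rm tr}(\mathcal E(\rho))]$. $wp^p.\mathbb E.Q$ is the largest projector $P$ with $\mathbb E\models_{tot}(\{P\},\{Q\})$; $wlp^p.\mathbb E.Q$ the largest projector $P$ with $\mathbb E\models_{par}(\{P\},\{Q\})$; $sp^p.\mathbb E.P$ the smallest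 projector $R$ with $\mathbb E\models_{par}(\{P\},\{R\})$. *)

theory Defs
  imports Complex_Main
begin

text \<open>Qubit variables are natural numbers. A computational basis state of the
register X (finite) is an assignment nat => bool that is False outside X.
Operators on H_X are matrices indexed by such basis states, represented as
functions asg => asg => complex that vanish outside the basis of X.\<close>

type_synonym asg = "nat \<Rightarrow> bool"
type_synonym op = "asg \<Rightarrow> asg \<Rightarrow> complex"
type_synonym sop = "op \<Rightarrow> op"

definition B :: "nat set \<Rightarrow> asg set" where
  "B X = {f. \<forall>q. q \<notin> X \<longrightarrow> \<not> f q}"

definition restr :: "nat set \<Rightarrow> asg \<Rightarrow> asg" where
  "restr X f = (\<lambda>q. if q \<in> X then f q else False)"

definition merge :: "nat set \<Rightarrow> asg \<Rightarrow> asg \<Rightarrow> asg" where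
  "merge X f g = (\<lambda>q. if q \<in> X then f q else g q)"

definition zop :: op where
  "zop = (\<lambda>_ _. 0)"

definition is_op :: "nat set \<Rightarrow> op \<Rightarrow> bool" where
  "is_op X A \<longleftrightarrow> (\<forall>f g. (f \<notin> B X \<or> g \<notin> B X) \<longrightarrow> A f g = 0)"

definition is_vec :: "nat set \<Rightarrow> (asg \<Rightarrow> complex) \<Rightarrow> bool" where
  "is_vec X v \<longleftrightarrow> (\<forall>f. f \<notin> B X \<longrightarrow> v f = 0)"

definition mult :: "nat set \<Rightarrow> op \<Rightarrow> op \<Rightarrow> op" where
  "mult X A C = (\<lambda>f g. \<Sum>h\<in>B X. A f h * C h g)"

definition app :: "nat set \<Rightarrow> op \<Rightarrow> (asg \<Rightarrow> complex) \<Rightarrow> (asg \<Rightarrow> complex)" where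
  "app X A v = (\<lambda>f. \<Sum>g\<in>B X. A f g * v g)"

definition adj :: "op \<Rightarrow> op" where
  "adj A = (\<lambda>f g. cnj (A g f))"

definition tr :: "nat set \<Rightarrow> op \<Rightarrow> complex" where
  "tr X A = (\<Sum>f\<in>B X. A f f)"

definition idop :: "nat set \<Rightarrow> op" where
  "idop X = (\<lambda>f g. if f \<in> B X \<and> f = g then 1 else 0)"

text \<open>Implicit extension A \<otimes> I_{X-U} of an operator A on H_U to H_X (U \<subseteq> X).\<close>
definition ext :: "nat set \<Rightarrow> nat set \<Rightarrow> op \<Rightarrow> op" where
  "ext U X A = (\<lambda>f g. if f \<in> B X \<and> g \<in> B X \<and> (\<forall>q\<in>X - U. f q = g q)
                      then A (restr U f) (restr U g) else 0)"

definition tensor :: "nat set \<Rightarrow> nat set \<Rightarrow> op \<Rightarrow> op \<Rightarrow> op" where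
  "tensor X Y A C = (\<lambda>f g. if f \<in> B (X \<union> Y) \<and> g \<in> B (X \<union> Y)
                      then A (restr X f) (restr X g) * C (restr Y f) (restr Y g) else 0)"

text \<open>Implicit extension E \<otimes> id_{X-V} of a super-operator E on L(H_V) to L(H_X).\<close>
definition sext :: "nat set \<Rightarrow> nat set \<Rightarrow> sop \<Rightarrow> sop" where
  "sext V X E \<rho> = (\<lambda>f g. if f \<in> B X \<and> g \<in> B X then
      E (\<lambda>f' g'. if f' \<in> B V \<and> g' \<in> B V then \<rho> (merge V f' f) (merge V g' g) else 0)
        (restr V f) (restr V g) else 0)"

definition psd :: "nat set \<Rightarrow> op \<Rightarrow> bool" where
  "psd X A \<longleftrightarrow> is_op X A \<and>
     (\<forall>v. let z = (\<Sum>f\<in>B X. \<Sum>g\<in>B X. cnj (v f) * A f g * v g) in Im z = 0 \<and> Re z \<ge> 0)"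

definition density :: "nat set \<Rightarrow> op \<Rightarrow> bool" where
  "density X \<rho> \<longleftrightarrow> psd X \<rho> \<and> Re (tr X \<rho>) \<le> 1"

definition proj :: "nat set \<Rightarrow> op \<Rightarrow> bool" where
  "proj X P \<longleftrightarrow> is_op X P \<and> mult X P P = P \<and> adj P = P"

definition rng :: "nat set \<Rightarrow> op \<Rightarrow> (asg \<Rightarrow> complex) set" where
  "rng X A = {app X A v | v. is_vec X v}"

definition vspan :: "(asg \<Rightarrow> complex) set \<Rightarrow> (asg \<Rightarrow> complex) set" where
  "vspan S = {v. \<exists>F c. finite F \<and> F \<subseteq> S \<and> v = (\<lambda>f. \<Sum>u\<in>F. c u * u f)}"

definition psub :: "nat set \<Rightarrow> op \<Rightarrow> op \<Rightarrow> bool" where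
  "psub X P Q \<longleftrightarrow> rng X P \<subseteq> rng X Q"

definition pmeet :: "nat set \<Rightarrow> op \<Rightarrow> op \<Rightarrow> op" where
  "pmeet X P Q = (THE R. proj X R \<and> rng X R = rng X P \<inter> rng X Q)"

definition pjoin :: "nat set \<Rightarrow> op \<Rightarrow> op \<Rightarrow> op" where
  "pjoin X P Q = (THE R. proj X R \<and> rng X R = vspan (rng X P \<union> rng X Q))"

text \<open>DProg(V): completely positive trace-nonincreasing super-operators on L(H_V)
(canonically zero on non-operators of H_V).\<close>
definition DProg :: "nat set \<Rightarrow> sop \<Rightarrow> bool" where
  "DProg V E \<longleftrightarrow>
     (\<forall>A. \<not> is_op V A \<longrightarrow> E A = zop) \<and>
     (\<forall>A. is_op V (E A)) \<and>
     (\<forall>A C. is_op V A \<longrightarrow> is_op V C \<longrightarrow>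
        E (\<lambda>f g. A f g + C f g) = (\<lambda>f g. E A f g + E C f g)) \<and>
     (\<forall>A c. is_op V A \<longrightarrow> E (\<lambda>f g. c * A f g) = (\<lambda>f g. c * E A f g)) \<and>
     (\<forall>X. finite X \<and> V \<subseteq> X \<longrightarrow> (\<forall>\<rho>. psd X \<rho> \<longrightarrow> psd X (sext V X E \<rho>))) \<and>
     (\<forall>\<rho>. psd V \<rho> \<longrightarrow> Re (tr V (E \<rho>)) \<le> Re (tr V \<rho>))"

definition NProg :: "nat set \<Rightarrow> sop set \<Rightarrow> bool" where
  "NProg V S \<longleftrightarrow> S \<noteq> {} \<and> (\<forall>E\<in>S. DProg V E) \<and>
     (\<forall>E1\<in>S. \<forall>E2\<in>S. \<forall>t::real. 0 \<le> t \<and> t \<le> 1 \<longrightarrow>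
        (\<lambda>A f g. complex_of_real t * E1 A f g + complex_of_real (1 - t) * E2 A f g) \<in> S) \<and>
     (\<forall>Es E. (\<forall>n. Es n \<in> S) \<and> (\<forall>A f g. (\<lambda>n. Es n A f g) \<longlonglongrightarrow> E A f g) \<longrightarrow> E \<in> S)"

definition sat_tot :: "sop set \<Rightarrow> nat set \<Rightarrow> nat set \<Rightarrow> op \<Rightarrow> nat set \<Rightarrow> op \<Rightarrow> bool" where
  "sat_tot S V U1 P U2 Q \<longleftrightarrow>
    (\<forall>X \<rho>. finite X \<and> V \<union> U1 \<union> U2 \<subseteq> X \<and> density X \<rho> \<longrightarrow>
       Re (tr X (mult X (ext U1 X P) \<rho>))
         \<le> (INF E\<in>S. Re (tr X (mult X (ext U2 X Q) (sext V X E \<rho>)))))"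

definition sat_par :: "sop set \<Rightarrow> nat set \<Rightarrow> nat set \<Rightarrow> op \<Rightarrow> nat set \<Rightarrow> op \<Rightarrow> bool" where
  "sat_par S V U1 P U2 Q \<longleftrightarrow>
    (\<forall>X \<rho>. finite X \<and> V \<union> U1 \<union> U2 \<subseteq> X \<and> density X \<rho> \<longrightarrow>
       Re (tr X (mult X (ext U1 X P) \<rho>))
         \<le> (INF E\<in>S. Re (tr X (mult X (ext U2 X Q) (sext V X E \<rho>)))
                     + Re (tr X \<rho>) - Re (tr X (sext V X E \<rho>))))"

definition wp :: "sop set \<Rightarrow> nat set \<Rightarrow> nat set \<Rightarrow> op \<Rightarrow> op" where
  "wp S V U Q = (THE P. proj (V \<union> U) P \<and> sat_tot S V (V \<union> U) P U Q \<and>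
      (\<forall>P'. proj (V \<union> U) P' \<and> sat_tot S V (V \<union> U) P' U Q \<longrightarrow> psub (V \<union> U) P' P))"

definition wlp :: "sop set \<Rightarrow> nat set \<Rightarrow> nat set \<Rightarrow> op \<Rightarrow> op" where
  "wlp S V U Q = (THE P. proj (V \<union> U) P \<and> sat_par S V (V \<union> U) P U Q \<and>
      (\<forall>P'. proj (V \<union> U) P' \<and> sat_par S V (V \<union> U) P' U Q \<longrightarrow> psub (V \<union> U) P' P))"

definition sp :: "sop set \<Rightarrow> nat set \<Rightarrow> nat set \<Rightarrow> op \<Rightarrow> op" where
  "sp S V U P = (THE R. proj (V \<union> U) R \<and> sat_par S V U P (V \<union> U) R \<and>
      (\<forall>R'. proj (V \<union> U) R' \<and> sat_par S V U P (V \<union> U) R' \<longrightarrow> psub (V \<union> U) R R'))"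

end

theory Submission
  imports Defs "HOL-Library.Function_Algebras" "HOL-Library.Complex_Order"
begin

text \<open>Write \<open>E\<^sup>*\<close> for the dual of a super-operator \<open>E\<close>, so that \<open>tr (A E(\<rho>)) = tr (E\<^sup>*(A) \<rho>)\<close>.
  A projector P lies below an effect M iff M acts as the identity on the range of P. Hence total
  correctness of (P, Q) says that every \<open>E\<^sup>*(Q)\<close> fixes the range of P, and partial correctness that
  every \<open>I - E\<^sup>*(I - Q)\<close> does; wp and wlp project onto the common fixed spaces of these effects. The
  second condition at v amounts to \<open>tr ((I - Q) E(|v><v|)) = 0\<close>, that is, to the range of
  \<open>E(|v><v|)\<close> lying in Q. So sp P projects onto the span of the ranges of all \<open>E(|v><v|)\<close> with v in P, and sp is
  the lower adjoint of wlp. The lattice laws follow from this adjunction and the splitting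
  \<open>I - E\<^sup>*(Q) = E\<^sup>*(I - Q) + (I - E\<^sup>*(I))\<close> into positive summands, the tensor laws from
  \<open>E\<^sup>*(A \<otimes> R) = E\<^sup>*(A) \<otimes> R\<close> and \<open>E(|v><v| \<otimes> |r><r|) = E(|v><v|) \<otimes> |r><r|\<close>.\<close>

section \<open>Basis states\<close>

lemma finite_B: "finite X \<Longrightarrow> finite (B X)"
  using finite_set_of_finite_funs[of X UNIV False] by (simp add: B_def)

lemma restr_in_B [simp]: "restr X f \<in> B X"
  by (auto simp: restr_def B_def)

lemma restr_eq_self: "f \<in> B X \<Longrightarrow> restr X f = f"
  by (auto simp: restr_def B_def)

lemma restr_restr: "Y \<subseteq> X \<Longrightarrow> restr Y (restr X f) = restr Y f"
  by (auto simp: restr_def fun_eq_iff)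

lemma merge_in_B: "a \<in> B X \<Longrightarrow> b \<in> B Y \<Longrightarrow> merge X a b \<in> B (X \<union> Y)"
  by (auto simp: merge_def B_def)

lemma restr_merge_left: "a \<in> B X \<Longrightarrow> restr X (merge X a b) = a"
  by (auto simp: restr_def merge_def B_def fun_eq_iff)

lemma restr_merge_right: "b \<in> B Y \<Longrightarrow> X \<inter> Y = {} \<Longrightarrow> restr Y (merge X a b) = b"
  by (auto simp: restr_def merge_def B_def fun_eq_iff)

lemma merge_restr: "f \<in> B (X \<union> Y) \<Longrightarrow> merge X (restr X f) (restr Y f) = f"
  by (auto simp: restr_def merge_def B_def fun_eq_iff)

lemma B_Un_cases:
  assumes "f \<in> B (X \<union> Y)"
  obtains a b where "a \<in> B X" "b \<in> B Y" "f = merge X a b"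
  using merge_restr[OF assms] restr_in_B by metis

lemma bij_betw_merge:
  assumes "X \<inter> Y = {}"
  shows "bij_betw (\<lambda>(a, b). merge X a b) (B X \<times> B Y) (B (X \<union> Y))"
  using assms
  by (intro bij_betw_byWitness[where f' = "\<lambda>f. (restr X f, restr Y f)"])
    (auto simp: restr_merge_left restr_merge_right merge_restr merge_in_B)

lemma sum_B_Un:
  assumes "X \<inter> Y = {}"
  shows "(\<Sum>f\<in>B (X \<union> Y). F f) = (\<Sum>a\<in>B X. \<Sum>b\<in>B Y. F (merge X a b))"
  using sum.reindex_bij_betw[OF bij_betw_merge[OF assms], of F]
  by (simp add: sum.cartesian_product case_prod_unfold)

section \<open>Vectors and operators\<close>

type_synonym vec = "asg \<Rightarrow> complex"

global_interpretation vec: vector_space "\<lambda>c (v :: vec) f. c * v f"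
  by standard (auto simp: fun_eq_iff algebra_simps)

abbreviation vecs :: "nat set \<Rightarrow> vec set" where
  "vecs X \<equiv> {v. is_vec X v}"

lemma sum_fun_apply: "(\<Sum>i\<in>I. F i) x = (\<Sum>i\<in>I. F i x)"
  for F :: "'i \<Rightarrow> 'a \<Rightarrow> 'b :: comm_monoid_add"
  by (induction I rule: infinite_finite_induct) simp_all

lemma vspan_eq_span: "vspan S = vec.span S"
proof -
  have "(\<Sum>u\<in>F. (\<lambda>f. c u * u f)) = (\<lambda>f. \<Sum>u\<in>F. c u * u f)" for F :: "vec set" and c
    by (simp add: fun_eq_iff sum_fun_apply)
  then show ?thesis by (auto simp: vspan_def vec.span_explicit)
qed

lemma subspace_vecs: "vec.subspace (vecs X)"
  by (auto simp: vec.subspace_def is_vec_def)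

lemma zop_eq_0: "zop = 0"
  by (simp add: zop_def fun_eq_iff)

lemma is_op_0 [simp]: "is_op X 0"
  by (simp add: is_op_def)

lemma is_op_idop [simp]: "is_op X (idop X)"
  by (auto simp: is_op_def idop_def)

lemma is_op_add: "is_op X A \<Longrightarrow> is_op X C \<Longrightarrow> is_op X (A + C)"
  by (auto simp: is_op_def)

lemma is_op_diff: "is_op X A \<Longrightarrow> is_op X C \<Longrightarrow> is_op X (A - C)"
  by (auto simp: is_op_def)

lemma is_op_mult: "is_op X A \<Longrightarrow> is_op X C \<Longrightarrow> is_op X (mult X A C)"
  by (auto simp: is_op_def mult_def)

lemma is_op_adj: "is_op X A \<Longrightarrow> is_op X (adj A)"
  by (auto simp: is_op_def adj_def)

lemma is_vec_0 [simp]: "is_vec X 0"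
  by (simp add: is_vec_def)

lemma is_vec_app: "is_op X A \<Longrightarrow> is_vec X (app X A v)"
  by (auto simp: is_op_def is_vec_def app_def)

lemma op_eqI:
  assumes "is_op X A" "is_op X C" "\<And>f g. f \<in> B X \<Longrightarrow> g \<in> B X \<Longrightarrow> A f g = C f g"
  shows "A = C"
  using assms unfolding is_op_def fun_eq_iff by metis

lemma vec_eqI:
  assumes "is_vec X u" "is_vec X v" "\<And>f. f \<in> B X \<Longrightarrow> u f = v f"
  shows "u = v"
  using assms unfolding is_vec_def fun_eq_iff by metis

global_interpretation app: module_hom
  "\<lambda>c (v :: vec) f. c * v f" "\<lambda>c (v :: vec) f. c * v f" "app X A" for X A
  by standard (simp_all add: fun_eq_iff app_def sum.distrib sum_distrib_left distrib_left mult_ac)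

lemma app_0_left [simp]: "app X 0 v = 0"
  by (simp add: fun_eq_iff app_def)

lemma app_add_left: "app X (A + C) v = app X A v + app X C v"
  by (simp add: fun_eq_iff app_def sum.distrib distrib_right)

lemma app_diff_left: "app X (A - C) v = app X A v - app X C v"
  by (simp add: fun_eq_iff app_def sum_subtractf left_diff_distrib)

lemma app_mult: "app X (mult X A C) v = app X A (app X C v)"
proof
  fix f
  have "app X (mult X A C) v f = (\<Sum>h\<in>B X. \<Sum>k\<in>B X. A f k * C k h * v h)"
    by (simp add: mult_def app_def sum_distrib_right)
  also have "\<dots> = (\<Sum>k\<in>B X. \<Sum>h\<in>B X. A f k * C k h * v h)" by (rule sum.swap)
  also have "\<dots> = app X A (app X C v) f"
    by (simp add: app_def sum_distrib_left mult.assoc)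
  finally show "app X (mult X A C) v f = app X A (app X C v) f" .
qed

lemma mult_0_left [simp]: "mult X 0 A = 0"
  by (simp add: fun_eq_iff mult_def)

lemma mult_0_right [simp]: "mult X A 0 = 0"
  by (simp add: fun_eq_iff mult_def)

lemma mult_add_left: "mult X (A + C) D = mult X A D + mult X C D"
  by (simp add: fun_eq_iff mult_def sum.distrib distrib_right)

lemma mult_add_right: "mult X D (A + C) = mult X D A + mult X D C"
  by (simp add: fun_eq_iff mult_def sum.distrib distrib_left)

lemma mult_diff_left: "mult X (A - C) D = mult X A D - mult X C D"
  by (simp add: fun_eq_iff mult_def sum_subtractf left_diff_distrib)

lemma mult_diff_right: "mult X D (A - C) = mult X D A - mult X D C"
  by (simp add: fun_eq_iff mult_def sum_subtractf right_diff_distrib)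

lemma tr_add: "tr X (A + C) = tr X A + tr X C"
  by (simp add: tr_def sum.distrib)

lemma tr_diff: "tr X (A - C) = tr X A - tr X C"
  by (simp add: tr_def sum_subtractf)

lemma adj_adj [simp]: "adj (adj A) = A"
  by (simp add: adj_def)

lemma adj_0 [simp]: "adj 0 = 0"
  by (simp add: adj_def fun_eq_iff)

lemma adj_idop [simp]: "adj (idop X) = idop X"
  unfolding adj_def idop_def by (intro ext) auto

lemma adj_add: "adj (A + C) = adj A + adj C"
  by (simp add: adj_def fun_eq_iff)

lemma adj_diff: "adj (A - C) = adj A - adj C"
  by (simp add: adj_def fun_eq_iff)

lemma adj_mult: "adj (mult X A C) = mult X (adj C) (adj A)"
  by (simp add: adj_def mult_def fun_eq_iff mult.commute)

definition ket :: "asg \<Rightarrow> vec" where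
  "ket f = (\<lambda>h. of_bool (h = f))"

lemma is_vec_ket: "f \<in> B X \<Longrightarrow> is_vec X (ket f)"
  by (auto simp: is_vec_def ket_def)

lemma app_ket:
  assumes "finite X" "g \<in> B X"
  shows "app X A (ket g) = (\<lambda>f. A f g)"
  using assms
  by (simp add: app_def ket_def of_bool_def if_distrib finite_B cong: if_cong)

lemma op_eq_ketI:
  assumes "finite X" "is_op X A" "is_op X C"
    and "\<And>g. g \<in> B X \<Longrightarrow> app X A (ket g) = app X C (ket g)"
  shows "A = C"
  using assms(4) by (intro op_eqI[OF assms(2,3)]) (simp add: app_ket assms(1) fun_eq_iff)

lemma vec_eq_sum_ket:
  assumes "finite X" "is_vec X v"
  shows "v = (\<Sum>f\<in>B X. (\<lambda>h. v f * ket f h))"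
proof (rule vec_eqI[OF assms(2)])
  show "is_vec X (\<Sum>f\<in>B X. (\<lambda>h. v f * ket f h))"
    by (auto simp: is_vec_def sum_fun_apply ket_def intro!: sum.neutral)
next
  fix g assume "g \<in> B X"
  then show "v g = (\<Sum>f\<in>B X. (\<lambda>h. v f * ket f h)) g"
    by (simp add: sum_fun_apply ket_def of_bool_def if_distrib assms finite_B cong: if_cong)
qed

lemma vecs_subset_span_ket: "finite X \<Longrightarrow> vecs X \<subseteq> vec.span (ket ` B X)"
proof
  fix v assume "finite X" "v \<in> vecs X"
  moreover have "(\<Sum>f\<in>B X. (\<lambda>h. v f * ket f h)) \<in> vec.span (ket ` B X)"
    by (intro vec.span_sum vec.span_scale vec.span_base imageI)
  ultimately show "v \<in> vec.span (ket ` B X)" using vec_eq_sum_ket[of X v] by simp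
qed

lemma app_idop:
  assumes "finite X" "is_vec X v"
  shows "app X (idop X) v = v"
proof (rule vec_eqI[OF is_vec_app[OF is_op_idop] assms(2)])
  fix f assume "f \<in> B X"
  then show "app X (idop X) v f = v f"
    by (simp add: app_def idop_def if_distrib if_distribR finite_B assms(1) cong: if_cong)
qed

lemma idop_mult: "finite X \<Longrightarrow> is_op X A \<Longrightarrow> mult X (idop X) A = A"
  by (rule op_eq_ketI[of X]) (simp_all add: is_op_mult app_mult app_idop is_vec_app)

lemma mult_idop: "finite X \<Longrightarrow> is_op X A \<Longrightarrow> mult X A (idop X) = A"
  by (rule op_eq_ketI[of X]) (simp_all add: is_op_mult app_mult app_idop is_vec_ket)

lemma app_compl_eq_0_iff:
  assumes "finite X" "is_vec X v"
  shows "app X (idop X - M) v = 0 \<longleftrightarrow> app X M v = v"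
  using app_idop[OF assms] by (auto simp: app_diff_left)

subsection \<open>Inner products and rank-one operators\<close>

definition ip :: "nat set \<Rightarrow> vec \<Rightarrow> vec \<Rightarrow> complex" where
  "ip X u v = (\<Sum>f\<in>B X. cnj (u f) * v f)"

definition outer :: "vec \<Rightarrow> vec \<Rightarrow> op" where
  "outer u v = (\<lambda>f g. u f * cnj (v g))"

lemma ip_0_right [simp]: "ip X u 0 = 0"
  by (simp add: ip_def)

lemma ip_add_left: "ip X (u + v) w = ip X u w + ip X v w"
  by (simp add: ip_def sum.distrib distrib_right)

lemma ip_add_right: "ip X u (v + w) = ip X u v + ip X u w"
  by (simp add: ip_def sum.distrib distrib_left)

lemma ip_diff_right: "ip X u (v - w) = ip X u v - ip X u w"
  by (simp add: ip_def sum_subtractf right_diff_distrib)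

lemma ip_scale_left: "ip X (\<lambda>f. c * u f) v = cnj c * ip X u v"
  by (simp add: ip_def sum_distrib_left mult_ac)

lemma ip_scale_right: "ip X u (\<lambda>f. c * v f) = c * ip X u v"
  by (simp add: ip_def sum_distrib_left mult_ac)

lemma cnj_ip: "cnj (ip X u v) = ip X v u"
  by (simp add: ip_def mult.commute)

lemma ip_app_adj: "ip X u (app X A v) = ip X (app X (adj A) u) v"
proof -
  have "ip X u (app X A v) = (\<Sum>f\<in>B X. \<Sum>g\<in>B X. cnj (u f) * A f g * v g)"
    by (simp add: ip_def app_def sum_distrib_left mult.assoc)
  also have "\<dots> = (\<Sum>g\<in>B X. \<Sum>f\<in>B X. cnj (u f) * A f g * v g)" by (rule sum.swap)
  also have "\<dots> = ip X (app X (adj A) u) v"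
    by (simp add: ip_def app_def adj_def sum_distrib_left mult_ac)
  finally show ?thesis .
qed

lemma ip_ket:
  assumes "finite X" "f \<in> B X"
  shows "ip X (ket f) v = v f"
  using assms by (simp add: ip_def ket_def of_bool_def if_distrib if_distribR finite_B
      cong: if_cong)

lemma cnj_mult_self_nonneg: "0 \<le> cnj z * z"
  by (simp add: less_eq_complex_def)

lemma ip_self_nonneg: "0 \<le> ip X v v"
  unfolding ip_def by (intro sum_nonneg cnj_mult_self_nonneg)

lemma ip_self_eq_0_iff:
  assumes "finite X" "is_vec X v"
  shows "ip X v v = 0 \<longleftrightarrow> v = 0"
proof
  assume "ip X v v = 0"
  then have "\<forall>f\<in>B X. cnj (v f) * v f = 0"
    unfolding ip_def
    by (subst (asm) sum_nonneg_eq_0_iff) (auto simp: finite_B assms(1) cnj_mult_self_nonneg)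
  then show "v = 0" using assms(2) by (intro vec_eqI[of X]) simp_all
qed simp

lemma complex_pos_of_real:
  assumes "0 \<le> z" "z \<noteq> 0"
  obtains r where "z = complex_of_real r" "0 < r"
  using assms that[of "Re z"] by (auto simp: less_eq_complex_def complex_eq_iff)

lemma ex_unit_multiple:
  assumes "finite X" "is_vec X v" "v \<noteq> 0"
  obtains c where "c \<noteq> 0" "ip X (\<lambda>f. c * v f) (\<lambda>f. c * v f) = 1"
proof -
  obtain r where ip_v: "ip X v v = complex_of_real r" "0 < r"
    using complex_pos_of_real[OF ip_self_nonneg] ip_self_eq_0_iff[OF assms(1,2)] assms(3) by metis
  define c where "c = complex_of_real (1 / sqrt r)"
  have "ip X (\<lambda>f. c * v f) (\<lambda>f. c * v f) = complex_of_real (1 / sqrt r * (1 / sqrt r) * r)"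
    by (simp only: ip_scale_left ip_scale_right ip_v(1) c_def complex_cnj_complex_of_real
        of_real_mult mult.assoc)
  also have "\<dots> = 1" using ip_v(2) by simp
  finally show thesis using that[of c] ip_v(2) by (simp add: c_def)
qed

lemma is_op_outer: "is_vec X u \<Longrightarrow> is_vec X v \<Longrightarrow> is_op X (outer u v)"
  by (auto simp: is_vec_def is_op_def outer_def)

lemma adj_outer: "adj (outer u v) = outer v u"
  by (simp add: adj_def outer_def mult.commute)

lemma app_outer: "app X (outer u v) w = (\<lambda>f. ip X v w * u f)"
  by (simp add: app_def outer_def ip_def fun_eq_iff sum_distrib_left mult_ac)

lemma mult_outer: "mult X A (outer u v) = outer (app X A u) v"
  by (simp add: mult_def outer_def app_def fun_eq_iff sum_distrib_right mult.assoc)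

lemma tr_outer: "tr X (outer u v) = ip X v u"
  by (simp add: tr_def outer_def ip_def mult.commute)

lemma tr_mult_outer: "tr X (mult X A (outer u v)) = ip X v (app X A u)"
  by (simp add: mult_outer tr_outer)

section \<open>Positive semidefinite operators\<close>

lemma psd_is_op: "psd X A \<Longrightarrow> is_op X A"
  by (simp add: psd_def)

lemma psd_ip_nonneg: "psd X A \<Longrightarrow> 0 \<le> ip X v (app X A v)"
  by (simp add: psd_def Let_def less_eq_complex_def ip_def app_def sum_distrib_left mult.assoc)

lemma psdI:
  assumes "is_op X A" "\<And>v. is_vec X v \<Longrightarrow> 0 \<le> ip X v (app X A v)"
  shows "psd X A"
proof -
  have "0 \<le> ip X v (app X A v)" for v
  proof -
    define w where "w = (\<lambda>f. if f \<in> B X then v f else 0)"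
    have "ip X w (app X A w) = ip X v (app X A v)" by (simp add: ip_def app_def w_def)
    moreover have "is_vec X w" by (simp add: w_def is_vec_def)
    ultimately show ?thesis using assms(2) by metis
  qed
  then show ?thesis
    using assms(1)
    by (simp add: psd_def Let_def less_eq_complex_def ip_def app_def sum_distrib_left mult.assoc)
qed

lemma psd_idop: "finite X \<Longrightarrow> psd X (idop X)"
  by (rule psdI) (simp_all add: app_idop ip_self_nonneg)

lemma psd_add: "psd X A \<Longrightarrow> psd X C \<Longrightarrow> psd X (A + C)"
  by (rule psdI) (simp_all add: is_op_add psd_is_op app_add_left ip_add_right psd_ip_nonneg)

lemma ip_app_outer: "ip X w (app X (outer u u) w) = complex_of_real ((cmod (ip X w u))\<^sup>2)"
  by (simp add: app_outer ip_scale_right complex_norm_square cnj_ip del: of_real_power)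

lemma psd_outer: "is_vec X v \<Longrightarrow> psd X (outer v v)"
  by (rule psdI) (simp_all add: is_op_outer ip_app_outer less_eq_complex_def)

lemma psd_conj:
  assumes "psd X A" "is_op X C"
  shows "psd X (mult X C (mult X A (adj C)))"
  using assms
  by (intro psdI)
    (simp_all add: is_op_mult is_op_adj psd_is_op app_mult ip_app_adj[of X _ C] psd_ip_nonneg)

lemma ip_app_add_scale:
  "ip X (u + (\<lambda>f. c * w f)) (app X A (u + (\<lambda>f. c * w f))) =
   ip X u (app X A u) + c * ip X u (app X A w) + cnj c * ip X w (app X A u)
   + c * cnj c * ip X w (app X A w)"
  by (simp add: app.add app.scale ip_add_left ip_add_right ip_scale_left ip_scale_right
      algebra_simps)

lemma psd_ip_commute:
  assumes "psd X A"
  shows "ip X w (app X A v) = cnj (ip X v (app X A w))"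
proof -
  have real: "Im (ip X u (app X A u)) = 0" for u
    using psd_ip_nonneg[OF assms, of u] by (simp add: less_eq_complex_def)
  have "Im (ip X v (app X A w) + ip X w (app X A v)) = 0"
    using real[of "v + (\<lambda>f. 1 * w f)"] unfolding ip_app_add_scale by (simp add: real)
  moreover have "Re (ip X v (app X A w)) - Re (ip X w (app X A v)) = 0"
    using real[of "v + (\<lambda>f. \<i> * w f)"] unfolding ip_app_add_scale by (simp add: real)
  ultimately show ?thesis by (simp add: complex_eq_iff)
qed

lemma psd_adj:
  assumes "finite X" "psd X A"
  shows "adj A = A"
proof (rule op_eqI[OF is_op_adj])
  fix f g assume "f \<in> B X" "g \<in> B X"
  then show "adj A f g = A f g"
    using psd_ip_commute[OF assms(2), of "ket f" "ket g"] assms(1)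
    by (simp add: ip_ket app_ket adj_def)
qed (use assms psd_is_op in auto)

lemma le_mult_of_quadratic_nonneg:
  fixes a b s :: real
  assumes "0 \<le> s" "0 \<le> b" and quadratic: "\<And>t. 0 \<le> a - 2 * t * s + t\<^sup>2 * s * b"
  shows "s \<le> a * b"
proof (cases "b = 0")
  case True
  have "s = 0"
  proof (rule ccontr)
    assume "s \<noteq> 0"
    then show False using quadratic[of "(a + 1) / (2 * s)"] True by simp
  qed
  then show ?thesis using True by simp
next
  case False
  have "0 \<le> a - 2 * (1 / b) * s + (1 / b)\<^sup>2 * s * b" by (rule quadratic)
  also have "\<dots> = a - s / b" using False by (simp add: power2_eq_square field_simps)
  finally show ?thesis using False assms(2) by (simp add: field_simps)
qed

lemma psd_Cauchy_Schwarz: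
  assumes "psd X A"
  shows "(cmod (ip X u (app X A w)))\<^sup>2 \<le> Re (ip X u (app X A u)) * Re (ip X w (app X A w))"
proof (rule le_mult_of_quadratic_nonneg)
  fix t :: real
  define z where "z = ip X u (app X A w)"
  define c where "c = - complex_of_real t * cnj z"
  have ip_w_u: "ip X w (app X A u) = cnj z" unfolding z_def by (rule psd_ip_commute[OF assms])
  have z_cnj_z: "z * cnj z = complex_of_real ((cmod z)\<^sup>2)"
    by (simp add: complex_norm_square del: of_real_power)
  have "c * z = complex_of_real (- t * (cmod z)\<^sup>2)"
    "cnj c * cnj z = complex_of_real (- t * (cmod z)\<^sup>2)"
    "c * cnj c = complex_of_real (t\<^sup>2 * (cmod z)\<^sup>2)"
    using z_cnj_z by (simp_all add: c_def mult_ac power2_eq_square)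
  then have "Re (ip X (u + (\<lambda>f. c * w f)) (app X A (u + (\<lambda>f. c * w f)))) =
      Re (ip X u (app X A u)) - 2 * t * (cmod z)\<^sup>2 + t\<^sup>2 * (cmod z)\<^sup>2 * Re (ip X w (app X A w))"
    unfolding ip_app_add_scale ip_w_u z_def[symmetric] by simp
  then show "0 \<le> Re (ip X u (app X A u)) - 2 * t * (cmod (ip X u (app X A w)))\<^sup>2
      + t\<^sup>2 * (cmod (ip X u (app X A w)))\<^sup>2 * Re (ip X w (app X A w))"
    using psd_ip_nonneg[OF assms] unfolding z_def less_eq_complex_def by (metis zero_complex.sel(1))
qed (use psd_ip_nonneg[OF assms, of w] in \<open>simp_all add: less_eq_complex_def\<close>)

lemma psd_app_eq_0:
  assumes "finite X" "psd X A" "ip X v (app X A v) = 0"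
  shows "app X A v = 0"
proof -
  have "ip X u (app X A v) = 0" for u
    using psd_Cauchy_Schwarz[OF assms(2), of u v] by (simp add: assms(3))
  then show ?thesis
    using ip_self_eq_0_iff[OF assms(1) is_vec_app[OF psd_is_op[OF assms(2)]]] by blast
qed

lemma psd_add_app_eq_0_iff:
  assumes "finite X" "psd X A" "psd X C"
  shows "app X (A + C) v = 0 \<longleftrightarrow> app X A v = 0 \<and> app X C v = 0"
proof
  assume "app X (A + C) v = 0"
  then have "ip X v (app X A v) + ip X v (app X C v) = 0"
    by (simp add: app_add_left flip: ip_add_right)
  then have "ip X v (app X A v) = 0" "ip X v (app X C v) = 0"
    using psd_ip_nonneg[OF assms(2), of v] psd_ip_nonneg[OF assms(3), of v]
    by (simp_all add: add_nonneg_eq_0_iff)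
  then show "app X A v = 0 \<and> app X C v = 0" using assms psd_app_eq_0 by blast
qed (simp add: app_add_left)

lemma psd_Schur_complement:
  assumes "psd X A" "ip X w (app X A w) = complex_of_real a" "0 < a" "(cmod c)\<^sup>2 = 1 / a"
  defines "u \<equiv> \<lambda>f. c * app X A w f"
  shows "psd X (A - outer u u)"
proof (rule psdI)
  show "is_op X (A - outer u u)"
    using psd_is_op[OF assms(1)] is_vec_app[of X A w]
    by (auto simp: u_def is_op_def is_vec_def outer_def)
next
  fix v
  have ip_outer: "ip X v (app X (outer u u) v) =
      complex_of_real ((cmod (ip X v (app X A w)))\<^sup>2 / a)"
    by (simp add: ip_app_outer u_def ip_scale_right norm_mult power_mult_distrib assms(4)
        del: of_real_power)
  have "(cmod (ip X v (app X A w)))\<^sup>2 \<le> Re (ip X v (app X A v)) * a"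
    using psd_Cauchy_Schwarz[OF assms(1), of v w] by (simp add: assms(2))
  then show "0 \<le> ip X v (app X (A - outer u u) v)"
    using psd_ip_nonneg[OF assms(1), of v] assms(3)
    by (simp add: app_diff_left ip_diff_right ip_outer less_eq_complex_def field_simps)
qed

lemma psd_eliminate:
  assumes "finite X" "psd X A" "app X A w \<noteq> 0"
  obtains u where "is_vec X u" "psd X (A - outer u u)" "app X (A - outer u u) w = 0"
    "\<And>v. app X A v = 0 \<Longrightarrow> app X (A - outer u u) v = 0"
proof -
  have "ip X w (app X A w) \<noteq> 0" using psd_app_eq_0[OF assms(1,2)] assms(3) by blast
  then obtain a where ip_w: "ip X w (app X A w) = complex_of_real a" "0 < a"
    by (rule complex_pos_of_real[OF psd_ip_nonneg[OF assms(2)]])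
  define c where "c = complex_of_real (1 / sqrt a)"
  have cmod_c: "(cmod c)\<^sup>2 = 1 / a" using ip_w(2) by (simp add: c_def norm_divide power_divide)
  define u where "u = (\<lambda>f. c * app X A w f)"
  have app_u: "app X (A - outer u u) v =
      app X A v - (\<lambda>f. ip X w (app X A v) / complex_of_real a * app X A w f)" for v
  proof -
    have "ip X u v = cnj c * ip X w (app X A v)"
      by (simp add: u_def ip_scale_left ip_app_adj[of X w] psd_adj[OF assms(1,2)])
    moreover have "cnj c * c = 1 / complex_of_real a"
      using cmod_c by (simp add: mult.commute flip: complex_norm_square of_real_power)
    ultimately show ?thesis by (simp add: app_diff_left app_outer fun_eq_iff u_def mult_ac)
  qed
  show thesis
  proof (rule that)
    show "is_vec X u" using is_vec_app[OF psd_is_op[OF assms(2)]] by (simp add: u_def is_vec_def)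
    show "psd X (A - outer u u)"
      unfolding u_def by (rule psd_Schur_complement[OF assms(2) ip_w cmod_c])
    show "app X (A - outer u u) w = 0" using ip_w by (simp add: app_u fun_eq_iff)
    show "app X (A - outer u u) v = 0" if "app X A v = 0" for v
      by (simp only: app_u that ip_0_right) (simp add: fun_eq_iff)
  qed
qed

text \<open>Cholesky decomposition: eliminating the nonzero columns one after the other leaves a sum of
  rank-one operators. It takes the place of a spectral decomposition.\<close>

lemma psd_induct [consumes 2, case_names zero add]:
  assumes "finite X" "psd X A"
    and zero: "P 0"
    and add: "\<And>C v. psd X C \<Longrightarrow> is_vec X v \<Longrightarrow> P C \<Longrightarrow> P (C + outer v v)"
  shows "P A"
  using assms(2)
proof (induction "card {g \<in> B X. app X A (ket g) \<noteq> 0}" arbitrary: A rule: less_induct)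
  case less
  show ?case
  proof (cases "\<exists>g\<in>B X. app X A (ket g) \<noteq> 0")
    case False
    then have "A = 0" by (intro op_eq_ketI[OF assms(1)]) (simp_all add: psd_is_op less.prems)
    then show ?thesis using zero by simp
  next
    case True
    then obtain g where nonzero: "g \<in> B X" "app X A (ket g) \<noteq> 0" by blast
    obtain u where eliminated: "is_vec X u" "psd X (A - outer u u)"
      "app X (A - outer u u) (ket g) = 0" "\<And>v. app X A v = 0 \<Longrightarrow> app X (A - outer u u) v = 0"
      using psd_eliminate[OF assms(1) less.prems nonzero(2)] by blast
    have "{h \<in> B X. app X (A - outer u u) (ket h) \<noteq> 0} \<subset> {h \<in> B X. app X A (ket h) \<noteq> 0}"
      using nonzero eliminated(3,4) by blast
    then have "P (A - outer u u)"
      using eliminated(2) finite_B[OF assms(1)] by (intro less.hyps psubset_card_mono) auto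
    then have "P (A - outer u u + outer u u)" using eliminated(1,2) add by blast
    then show ?thesis by simp
  qed
qed

lemma tr_mult_add_outer:
  "tr X (mult X A (C + outer v v)) = tr X (mult X A C) + ip X v (app X A v)"
  by (simp add: mult_add_right tr_add tr_mult_outer)

lemma tr_mult_psd_nonneg:
  assumes "finite X" "psd X A" "psd X C"
  shows "0 \<le> tr X (mult X A C)"
  using assms(1,3)
proof (induction C rule: psd_induct)
  case (add C v)
  then have "0 \<le> tr X (mult X A C) + ip X v (app X A v)"
    using psd_ip_nonneg[OF assms(2)] by simp
  then show ?case by (simp only: tr_mult_add_outer)
next
  case zero
  show ?case by (simp only: mult_0_right) (simp add: tr_def)
qed

lemma psd_mult_eq_0:
  assumes "finite X" "psd X A" "psd X C" "tr X (mult X A C) = 0"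
  shows "mult X A C = 0"
  using assms(1,3,4)
proof (induction C rule: psd_induct)
  case (add C v)
  have "tr X (mult X A C) + ip X v (app X A v) = 0"
    using add.prems by (simp only: tr_mult_add_outer)
  then have "tr X (mult X A C) = 0" "ip X v (app X A v) = 0"
    using psd_ip_nonneg[OF assms(2), of v] tr_mult_psd_nonneg[OF assms(1,2) add.hyps(1)]
    by (simp_all add: add_nonneg_eq_0_iff)
  then have "mult X A C = 0" "app X A v = 0"
    using add.IH psd_app_eq_0[OF assms(1,2)] by blast+
  moreover have "outer 0 v = 0" by (simp add: outer_def fun_eq_iff)
  ultimately show ?case by (simp only: mult_add_right mult_outer) simp
qed simp

lemma tr_psd_nonneg:
  assumes "finite X" "psd X A"
  shows "0 \<le> tr X A"
  using tr_mult_psd_nonneg[OF assms(1) psd_idop[OF assms(1)] assms(2)]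
  by (simp add: idop_mult assms(1) psd_is_op[OF assms(2)])

section \<open>Projectors and subspaces\<close>

lemma proj_is_op: "proj X P \<Longrightarrow> is_op X P"
  by (simp add: proj_def)

lemma proj_idem: "proj X P \<Longrightarrow> mult X P P = P"
  by (simp add: proj_def)

lemma proj_adj: "proj X P \<Longrightarrow> adj P = P"
  by (simp add: proj_def)

lemma proj_0 [simp]: "proj X 0"
  by (simp add: proj_def)

lemma proj_idop [simp]: "finite X \<Longrightarrow> proj X (idop X)"
  by (simp add: proj_def idop_mult)

lemma proj_compl:
  assumes "finite X" "proj X P"
  shows "proj X (idop X - P)"
  using assms
  by (simp add: proj_def is_op_diff adj_diff mult_diff_left mult_diff_right idop_mult mult_idop)

lemma psd_proj:
  assumes "finite X" "proj X P"
  shows "psd X P"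
  using psd_conj[OF psd_idop[OF assms(1)] proj_is_op[OF assms(2)]] assms
  by (simp add: proj_def idop_mult)

lemma rng_0 [simp]: "rng X 0 = {0}"
  by (auto simp: rng_def intro: exI[of _ 0])

lemma rng_subset_vecs: "is_op X A \<Longrightarrow> rng X A \<subseteq> vecs X"
  by (auto simp: rng_def is_vec_app)

lemma subspace_rng: "vec.subspace (rng X A)"
proof -
  have "rng X A = app X A ` vecs X" by (auto simp: rng_def)
  then show ?thesis using app.subspace_image[OF subspace_vecs] by simp
qed

lemma rng_proj:
  assumes "proj X P"
  shows "rng X P = {v. is_vec X v \<and> app X P v = v}"
proof -
  have "app X P (app X P w) = app X P w" for w
    using app_mult[of X P P w] by (simp add: proj_idem[OF assms])
  then show ?thesis
    using is_vec_app[OF proj_is_op[OF assms]] by (force simp: rng_def)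
qed

lemma rng_idop: "finite X \<Longrightarrow> rng X (idop X) = vecs X"
  by (auto simp: rng_proj app_idop)

lemma mult_eq_self_iff_fixes_rng:
  assumes "finite X" "is_op X M" "is_op X A"
  shows "mult X M A = A \<longleftrightarrow> (\<forall>v\<in>rng X A. app X M v = v)"
proof
  assume "mult X M A = A"
  then show "\<forall>v\<in>rng X A. app X M v = v"
    using app_mult[of X M A] by (auto simp: rng_def)
next
  assume fixes_rng: "\<forall>v\<in>rng X A. app X M v = v"
  show "mult X M A = A"
  proof (rule op_eq_ketI[OF assms(1) is_op_mult[OF assms(2,3)] assms(3)])
    fix g assume "g \<in> B X"
    then have "app X A (ket g) \<in> rng X A" using is_vec_ket by (auto simp: rng_def)
    then show "app X (mult X M A) (ket g) = app X A (ket g)" using fixes_rng by (simp add: app_mult)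
  qed
qed

lemma rng_subset_proj_iff:
  assumes "finite X" "is_op X A" "proj X P"
  shows "rng X A \<subseteq> rng X P \<longleftrightarrow> mult X P A = A"
  using rng_subset_vecs[OF assms(2)]
  by (auto simp: rng_proj[OF assms(3)] mult_eq_self_iff_fixes_rng assms proj_is_op)

lemma psub_iff_mult_left:
  "finite X \<Longrightarrow> proj X P \<Longrightarrow> proj X Q \<Longrightarrow> psub X P Q \<longleftrightarrow> mult X Q P = P"
  by (simp add: psub_def rng_subset_proj_iff proj_is_op)

lemma psub_iff_mult_right:
  assumes "finite X" "proj X P" "proj X Q"
  shows "psub X P Q \<longleftrightarrow> mult X P Q = P"
proof -
  have "mult X Q P = P \<longleftrightarrow> adj (mult X Q P) = adj P" by (metis adj_adj)
  then show ?thesis using assms by (simp add: psub_iff_mult_left adj_mult proj_adj)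
qed

lemma psub_refl [simp]: "psub X P P"
  by (simp add: psub_def)

lemma psub_trans: "psub X P Q \<Longrightarrow> psub X Q R \<Longrightarrow> psub X P R"
  by (auto simp: psub_def)

lemma psub_0 [simp]: "psub X 0 P"
  using vec.subspace_0[OF subspace_rng] by (simp add: psub_def)

lemma psub_antisym:
  assumes "finite X" "proj X P" "proj X Q" "psub X P Q" "psub X Q P"
  shows "P = Q"
  using assms psub_iff_mult_left psub_iff_mult_right by metis

lemma proj_eqI: "finite X \<Longrightarrow> proj X P \<Longrightarrow> proj X Q \<Longrightarrow> rng X P = rng X Q \<Longrightarrow> P = Q"
  by (rule psub_antisym[of X]) (simp_all add: psub_def)

lemma psub_compl_iff:
  assumes "finite X" "proj X P" "proj X Q"
  shows "psub X (idop X - P) (idop X - Q) \<longleftrightarrow> psub X Q P"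
proof -
  have "mult X (idop X - Q) (idop X - P) = idop X - P - (Q - mult X Q P)"
    using assms by (simp add: mult_diff_left mult_diff_right idop_mult mult_idop proj_is_op
        is_op_diff)
  then show ?thesis
    using assms by (auto simp: psub_iff_mult_left[OF _ proj_compl proj_compl] psub_iff_mult_right)
qed

lemma compl_psub_commute:
  assumes "finite X" "proj X P" "proj X Q"
  shows "psub X (idop X - P) Q \<longleftrightarrow> psub X (idop X - Q) P"
  using psub_compl_iff[OF assms(1,2) proj_compl[OF assms(1,3)]] by simp

lemma psub_compl_commute:
  assumes "finite X" "proj X P" "proj X Q"
  shows "psub X P (idop X - Q) \<longleftrightarrow> psub X Q (idop X - P)"
  using psub_compl_iff[OF assms(1) proj_compl[OF assms(1,2)] assms(3)] by simp

lemma mem_rng_outer_self: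
  assumes "finite X" "is_vec X r"
  shows "r \<in> rng X (outer r r)"
proof (cases "r = 0")
  case True
  then show ?thesis using vec.subspace_0[OF subspace_rng] by simp
next
  case False
  then have "ip X r r \<noteq> 0" by (simp add: ip_self_eq_0_iff assms)
  then have "app X (outer r r) (\<lambda>f. inverse (ip X r r) * r f) = r"
    by (simp add: app_outer ip_scale_right)
  moreover have "is_vec X (\<lambda>f. inverse (ip X r r) * r f)" using assms(2) by (simp add: is_vec_def)
  ultimately show ?thesis unfolding rng_def by (metis (mono_tags, lifting) mem_Collect_eq)
qed

lemma rng_outer_self:
  assumes "finite X" "is_vec X u"
  shows "rng X (outer u u) = vec.span {u}"
proof
  show "rng X (outer u u) \<subseteq> vec.span {u}"
    by (auto simp: rng_def app_outer vec.span_singleton)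
  show "vec.span {u} \<subseteq> rng X (outer u u)"
    using mem_rng_outer_self[OF assms] by (intro vec.span_minimal subspace_rng) simp
qed

lemma rng_outer_self_subset:
  assumes "finite X" "proj X R" "r \<in> rng X R"
  shows "rng X (outer r r) \<subseteq> rng X R"
proof -
  have "rng X (outer r r) = vec.span {r}"
    using assms by (intro rng_outer_self) (simp_all add: rng_proj)
  then show ?thesis using assms(3) vec.span_minimal[OF _ subspace_rng, of "{r}"] by simp
qed

subsection \<open>Every subspace is the range of a projector\<close>

lemma proj_outer: "is_vec X u \<Longrightarrow> ip X u u = 1 \<Longrightarrow> proj X (outer u u)"
  by (simp add: proj_def is_op_outer adj_outer mult_outer app_outer)

lemma proj_mult_eq_0_commute:
  assumes "proj X P" "proj X Q" "mult X P Q = 0"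
  shows "mult X Q P = 0"
  using arg_cong[OF assms(3), of adj]
  by (simp add: adj_mult proj_adj[OF assms(1)] proj_adj[OF assms(2)])

lemma proj_add:
  assumes "proj X P" "proj X Q" "mult X P Q = 0"
  shows "proj X (P + Q)"
  using assms proj_mult_eq_0_commute[OF assms]
  by (simp add: proj_def is_op_add adj_add mult_add_left mult_add_right)

lemma rng_proj_add:
  assumes "finite X" "proj X P" "proj X Q" "mult X P Q = 0"
  shows "rng X (P + Q) = vec.span (rng X P \<union> rng X Q)"
proof
  have "app X P y \<in> rng X P" "app X Q y \<in> rng X Q" if "is_vec X y" for y
    using that by (auto simp: rng_def)
  then show "rng X (P + Q) \<subseteq> vec.span (rng X P \<union> rng X Q)"
    by (auto simp: rng_def[of X "P + Q"] app_add_left intro!: vec.span_add intro: vec.span_base)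
  have "rng X P \<subseteq> rng X (P + Q)" "rng X Q \<subseteq> rng X (P + Q)"
    using assms proj_mult_eq_0_commute[OF assms(2-4)]
    by (simp_all add: rng_subset_proj_iff proj_add proj_is_op mult_add_left proj_idem)
  then show "vec.span (rng X P \<union> rng X Q) \<subseteq> rng X (P + Q)"
    by (intro vec.span_minimal subspace_rng) simp
qed

lemma span_insert_scale_diff:
  assumes "c \<noteq> 0" "p \<in> K"
  shows "vec.span (insert (\<lambda>f. c * (v - p) f) K) = vec.span (insert v K)"
  unfolding vec.span_eq
proof
  have "(\<lambda>f. c * (v - p) f) \<in> vec.span (insert v K)"
    using assms(2) by (intro vec.span_scale vec.span_diff vec.span_base) auto
  then show "insert (\<lambda>f. c * (v - p) f) K \<subseteq> vec.span (insert v K)"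
    by (auto intro: vec.span_base)
  have "p + (\<lambda>f. inverse c * (c * (v - p) f)) \<in> vec.span (insert (\<lambda>f. c * (v - p) f) K)"
    using assms(2) by (intro vec.span_add vec.span_scale vec.span_base) auto
  moreover have "p + (\<lambda>f. inverse c * (c * (v - p) f)) = v" using assms(1) by (simp add: fun_eq_iff)
  ultimately show "insert v K \<subseteq> vec.span (insert (\<lambda>f. c * (v - p) f) K)"
    by (auto intro: vec.span_base)
qed

text \<open>One Gram-Schmidt step: add the rank-one projector onto the normalized component of v
  orthogonal to P.\<close>

lemma ex_proj_span_insert:
  assumes "finite X" "proj X P" "is_vec X v"
  shows "\<exists>P'. proj X P' \<and> rng X P' = vec.span (insert v (rng X P))"
proof (cases "app X P v = v")
  case True
  then have "insert v (rng X P) = rng X P" using assms(2,3) by (auto simp: rng_proj)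
  then show ?thesis using assms(2) subspace_rng vec.span_eq_iff by metis
next
  case False
  define w where "w = v - app X P v"
  have Pv_in_rng: "app X P v \<in> rng X P" using assms(3) by (auto simp: rng_def)
  have w_vec: "is_vec X w" "w \<noteq> 0"
    using False vec.subspace_diff[OF subspace_vecs, of v X] assms(3)
      is_vec_app[OF proj_is_op[OF assms(2)], of v] by (auto simp: w_def)
  obtain c where normalized: "c \<noteq> 0" "ip X (\<lambda>f. c * w f) (\<lambda>f. c * w f) = 1"
    using ex_unit_multiple[OF assms(1) w_vec] by blast
  define u where "u = (\<lambda>f. c * w f)"
  have unit: "is_vec X u" "ip X u u = 1"
    using w_vec(1) normalized(2) by (simp_all add: u_def is_vec_def)
  have "app X P w = 0" using Pv_in_rng assms(2) by (simp add: w_def app.diff rng_proj)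
  then have "app X P u = 0" by (simp add: u_def app.scale fun_eq_iff)
  then have orthogonal: "mult X P (outer u u) = 0"
    by (simp only: mult_outer) (simp add: outer_def fun_eq_iff)
  have "rng X (P + outer u u) = vec.span (rng X P \<union> vec.span {u})"
    using rng_proj_add[OF assms(1,2) proj_outer[OF unit] orthogonal]
    by (simp add: rng_outer_self assms(1) unit)
  also have "\<dots> = vec.span (insert u (rng X P))"
    using vec.span_Un[of "rng X P" "vec.span {u}"] vec.span_Un[of "rng X P" "{u}"]
    by (simp add: vec.span_span)
  also have "\<dots> = vec.span (insert v (rng X P))"
    unfolding u_def w_def by (rule span_insert_scale_diff[OF normalized(1) Pv_in_rng])
  finally show ?thesis using proj_add[OF assms(2) proj_outer[OF unit] orthogonal] by blast
qed

lemma ex_proj_span: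
  assumes "finite X" "finite F" "F \<subseteq> vecs X"
  shows "\<exists>P. proj X P \<and> rng X P = vec.span F"
  using assms(2,3)
proof (induction F rule: finite_induct)
  case empty
  then show ?case using proj_0 rng_0 vec.span_empty by metis
next
  case (insert v F)
  then obtain P where proj_P: "proj X P" "rng X P = vec.span F" by auto
  have "vec.span (insert v (vec.span F)) = vec.span (insert v F)"
    by (simp add: vec.span_insert vec.span_span)
  then show ?case
    using ex_proj_span_insert[OF assms(1) proj_P(1), of v] insert.prems proj_P(2) by simp
qed

lemma ex_proj_rng:
  assumes "finite X" "vec.subspace K" "K \<subseteq> vecs X"
  shows "\<exists>P. proj X P \<and> rng X P = K"
proof -
  obtain F where basis: "F \<subseteq> K" "vec.independent F" "K \<subseteq> vec.span F"
    using vec.maximal_independent_subset by blast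
  have "finite F"
    using vec.independent_span_bound[of "ket ` B X" F] vecs_subset_span_ket[OF assms(1)]
      finite_B[OF assms(1)] basis(1,2) assms(3) by blast
  moreover have "vec.span F = K" using basis(1,3) assms(2) by (rule vec.span_subspace)
  ultimately show ?thesis using ex_proj_span[OF assms(1)] basis(1) assms(3) by blast
qed

subsection \<open>Meets and joins\<close>

lemma the_proj_rng:
  assumes "finite X" "vec.subspace K" "K \<subseteq> vecs X"
  shows "proj X (THE R. proj X R \<and> rng X R = K) \<and> rng X (THE R. proj X R \<and> rng X R = K) = K"
proof -
  obtain R where proj_R: "proj X R" "rng X R = K" using ex_proj_rng[OF assms] by blast
  have "(THE R. proj X R \<and> rng X R = K) = R"
    using proj_R proj_eqI[OF assms(1)] by (intro the_equality) auto
  then show ?thesis using proj_R by simp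
qed

lemma
  assumes "finite X" "proj X P" "proj X Q"
  shows proj_pmeet: "proj X (pmeet X P Q)"
    and rng_pmeet: "rng X (pmeet X P Q) = rng X P \<inter> rng X Q"
proof -
  have "rng X P \<inter> rng X Q \<subseteq> vecs X" using rng_subset_vecs[OF proj_is_op[OF assms(2)]] by auto
  with the_proj_rng[OF assms(1) vec.subspace_inter[OF subspace_rng subspace_rng]]
  show "proj X (pmeet X P Q)" "rng X (pmeet X P Q) = rng X P \<inter> rng X Q"
    unfolding pmeet_def by simp_all
qed

lemma
  assumes "finite X" "proj X P" "proj X Q"
  shows proj_pjoin: "proj X (pjoin X P Q)"
    and rng_pjoin: "rng X (pjoin X P Q) = vec.span (rng X P \<union> rng X Q)"
proof -
  have "rng X P \<union> rng X Q \<subseteq> vecs X"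
    using assms(2,3) by (simp add: rng_subset_vecs proj_is_op)
  then have "vec.span (rng X P \<union> rng X Q) \<subseteq> vecs X"
    by (rule vec.span_minimal[OF _ subspace_vecs])
  with the_proj_rng[OF assms(1) vec.subspace_span]
  show "proj X (pjoin X P Q)" "rng X (pjoin X P Q) = vec.span (rng X P \<union> rng X Q)"
    unfolding pjoin_def vspan_eq_span by simp_all
qed

lemma psub_pmeet_iff:
  "finite X \<Longrightarrow> proj X P \<Longrightarrow> proj X Q \<Longrightarrow>
    psub X R (pmeet X P Q) \<longleftrightarrow> psub X R P \<and> psub X R Q"
  by (auto simp: psub_def rng_pmeet)

lemma pjoin_psub_iff:
  assumes "finite X" "proj X P" "proj X Q"
  shows "psub X (pjoin X P Q) R \<longleftrightarrow> psub X P R \<and> psub X Q R"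
  using vec.span_superset[of "rng X P \<union> rng X Q"]
    vec.span_minimal[OF _ subspace_rng, of "rng X P \<union> rng X Q" X R]
  by (auto simp: psub_def rng_pjoin[OF assms])

lemma pjoin_eq_compl_pmeet:
  assumes "finite X" "proj X P" "proj X Q"
  shows "pjoin X P Q = idop X - pmeet X (idop X - P) (idop X - Q)"
proof (rule psub_antisym[OF assms(1)])
  have proj_compls: "proj X (idop X - P)" "proj X (idop X - Q)" using assms proj_compl by auto
  let ?M = "pmeet X (idop X - P) (idop X - Q)" and ?J = "pjoin X P Q"
  have proj_M: "proj X ?M" by (rule proj_pmeet[OF assms(1) proj_compls])
  show proj_J: "proj X ?J" by (rule proj_pjoin[OF assms])
  show "proj X (idop X - ?M)" by (rule proj_compl[OF assms(1) proj_M])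
  have "psub X ?M (idop X - P)" "psub X ?M (idop X - Q)"
    using psub_pmeet_iff[OF assms(1) proj_compls, of ?M] by simp_all
  then have "psub X P (idop X - ?M)" "psub X Q (idop X - ?M)"
    using assms proj_M by (simp_all add: psub_compl_commute[of X _ ?M])
  then show "psub X ?J (idop X - ?M)" by (simp add: pjoin_psub_iff assms)
  have "psub X P ?J" "psub X Q ?J" using pjoin_psub_iff[OF assms, of ?J] by simp_all
  then have "psub X (idop X - ?J) ?M"
    using assms proj_J by (simp add: psub_pmeet_iff proj_compls psub_compl_iff)
  then show "psub X (idop X - ?M) ?J" using assms(1) proj_M proj_J by (simp add: compl_psub_commute)
qed

section \<open>Tensor products\<close>

lemma is_op_tensor [simp]: "is_op (Y \<union> Z) (tensor Y Z A C)"
  by (auto simp: is_op_def tensor_def)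

lemma tensor_merge:
  assumes "Y \<inter> Z = {}" "a \<in> B Y" "a' \<in> B Y" "b \<in> B Z" "b' \<in> B Z"
  shows "tensor Y Z A C (merge Y a b) (merge Y a' b') = A a a' * C b b'"
  using assms by (simp add: tensor_def merge_in_B restr_merge_left restr_merge_right)

lemma adj_tensor: "adj (tensor Y Z A C) = tensor Y Z (adj A) (adj C)"
  by (auto simp: adj_def tensor_def fun_eq_iff)

lemma tr_tensor:
  assumes "Y \<inter> Z = {}"
  shows "tr (Y \<union> Z) (tensor Y Z A C) = tr Y A * tr Z C"
  using assms by (simp add: tr_def sum_B_Un tensor_merge sum_product)

lemma mult_tensor:
  assumes "Y \<inter> Z = {}"
  shows "mult (Y \<union> Z) (tensor Y Z A C) (tensor Y Z A' C') = tensor Y Z (mult Y A A') (mult Z C C')"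
proof (rule op_eqI[of "Y \<union> Z"])
  fix f g assume "f \<in> B (Y \<union> Z)" "g \<in> B (Y \<union> Z)"
  then obtain a b a' b' where fg_eq: "a \<in> B Y" "b \<in> B Z" "f = merge Y a b"
     "a' \<in> B Y" "b' \<in> B Z" "g = merge Y a' b'" by (metis B_Un_cases)
  have "mult (Y \<union> Z) (tensor Y Z A C) (tensor Y Z A' C') f g =
     (\<Sum>x\<in>B Y. \<Sum>y\<in>B Z. (A a x * A' x a') * (C b y * C' y b'))"
    unfolding mult_def sum_B_Un[OF assms] using fg_eq assms by (simp add: tensor_merge mult_ac)
  also have "\<dots> = tensor Y Z (mult Y A A') (mult Z C C') f g"
    using fg_eq assms by (simp add: tensor_merge mult_def sum_product)
  finally show "mult (Y \<union> Z) (tensor Y Z A C) (tensor Y Z A' C') f g =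
    tensor Y Z (mult Y A A') (mult Z C C') f g" .
qed (auto intro: is_op_mult)

lemma tensor_idop: "tensor Y Z (idop Y) (idop Z) = idop (Y \<union> Z)"
proof (rule op_eqI[of "Y \<union> Z"])
  fix f g assume fg_in_B: "f \<in> B (Y \<union> Z)" "g \<in> B (Y \<union> Z)"
  then have "restr Y f = restr Y g \<and> restr Z f = restr Z g \<longleftrightarrow> f = g" by (metis merge_restr)
  with fg_in_B show "tensor Y Z (idop Y) (idop Z) f g = idop (Y \<union> Z) f g"
    by (simp add: tensor_def idop_def) blast
qed auto

lemma proj_tensor:
  "Y \<inter> Z = {} \<Longrightarrow> proj Y P \<Longrightarrow> proj Z R \<Longrightarrow> proj (Y \<union> Z) (tensor Y Z P R)"
  by (simp add: proj_def mult_tensor adj_tensor)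

lemma rng_tensor_mono:
  assumes "Y \<inter> Z = {}" "finite Y" "finite Z" "is_op Y A" "is_op Z C" "proj Y P" "proj Z R"
    and "rng Y A \<subseteq> rng Y P" "rng Z C \<subseteq> rng Z R"
  shows "rng (Y \<union> Z) (tensor Y Z A C) \<subseteq> rng (Y \<union> Z) (tensor Y Z P R)"
  using assms by (simp add: rng_subset_proj_iff proj_tensor mult_tensor)

subsection \<open>Product vectors\<close>

definition tensor_vec :: "nat set \<Rightarrow> nat set \<Rightarrow> vec \<Rightarrow> vec \<Rightarrow> vec" where
  "tensor_vec Y Z u r = (\<lambda>f. if f \<in> B (Y \<union> Z) then u (restr Y f) * r (restr Z f) else 0)"

global_interpretation tensor_vec: module_hom "\<lambda>c (v :: vec) f. c * v f" "\<lambda>c (v :: vec) f. c * v f"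
  "\<lambda>u. tensor_vec Y Z u r" for Y Z r
  by standard (simp_all add: fun_eq_iff tensor_vec_def distrib_right mult.assoc)

lemma is_vec_tensor_vec [simp]: "is_vec (Y \<union> Z) (tensor_vec Y Z u r)"
  by (simp add: is_vec_def tensor_vec_def)

lemma tensor_vec_ket:
  assumes "Y \<inter> Z = {}" "a \<in> B Y" "b \<in> B Z"
  shows "tensor_vec Y Z (ket a) (ket b) = ket (merge Y a b)"
proof (rule vec_eqI[of "Y \<union> Z"])
  fix f assume "f \<in> B (Y \<union> Z)"
  then obtain c d where f_eq: "c \<in> B Y" "d \<in> B Z" "f = merge Y c d" by (rule B_Un_cases)
  then have "f = merge Y a b \<longleftrightarrow> c = a \<and> d = b"
    using assms restr_merge_left restr_merge_right by metis
  then show "tensor_vec Y Z (ket a) (ket b) f = ket (merge Y a b) f"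
    using f_eq assms
    by (simp add: tensor_vec_def ket_def merge_in_B restr_merge_left restr_merge_right)
qed (simp_all add: assms is_vec_ket merge_in_B)

lemma outer_tensor_vec:
  "outer (tensor_vec Y Z u r) (tensor_vec Y Z v s) = tensor Y Z (outer u v) (outer r s)"
  by (auto simp: outer_def tensor_vec_def tensor_def fun_eq_iff)

lemma app_tensor_tensor_vec:
  assumes "Y \<inter> Z = {}"
  shows "app (Y \<union> Z) (tensor Y Z A C) (tensor_vec Y Z u r) = tensor_vec Y Z (app Y A u) (app Z C r)"
proof (rule vec_eqI[of "Y \<union> Z"])
  fix f assume "f \<in> B (Y \<union> Z)"
  then obtain a b where f_eq: "a \<in> B Y" "b \<in> B Z" "f = merge Y a b" by (rule B_Un_cases)
  have "app (Y \<union> Z) (tensor Y Z A C) (tensor_vec Y Z u r) f =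
      (\<Sum>x\<in>B Y. \<Sum>y\<in>B Z. (A a x * u x) * (C b y * r y))"
    unfolding app_def sum_B_Un[OF assms] using f_eq assms
    by (simp add: tensor_merge tensor_vec_def merge_in_B restr_merge_left restr_merge_right mult_ac)
  also have "\<dots> = tensor_vec Y Z (app Y A u) (app Z C r) f"
    using f_eq assms
    by (simp add: tensor_vec_def merge_in_B restr_merge_left restr_merge_right app_def sum_product)
  finally show "app (Y \<union> Z) (tensor Y Z A C) (tensor_vec Y Z u r) f =
    tensor_vec Y Z (app Y A u) (app Z C r) f" .
qed (auto simp: is_vec_app)

lemma tensor_vec_in_rng_tensor:
  assumes "Y \<inter> Z = {}" "u \<in> rng Y A" "r \<in> rng Z C"
  shows "tensor_vec Y Z u r \<in> rng (Y \<union> Z) (tensor Y Z A C)"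
proof -
  obtain v s where "u = app Y A v" "r = app Z C s" using assms(2,3) by (auto simp: rng_def)
  then have "tensor_vec Y Z u r = app (Y \<union> Z) (tensor Y Z A C) (tensor_vec Y Z v s)"
    by (simp add: app_tensor_tensor_vec assms(1))
  then show ?thesis unfolding rng_def using is_vec_tensor_vec by blast
qed

lemma rng_tensor_subset:
  assumes "Y \<inter> Z = {}" "finite Y" "finite Z" "vec.subspace K"
    and products: "\<And>u r. u \<in> rng Y A \<Longrightarrow> r \<in> rng Z C \<Longrightarrow> tensor_vec Y Z u r \<in> K"
  shows "rng (Y \<union> Z) (tensor Y Z A C) \<subseteq> K"
proof -
  let ?T = "app (Y \<union> Z) (tensor Y Z A C)"
  have "ket ` B (Y \<union> Z) \<subseteq> ?T -` K"
  proof
    fix v assume "v \<in> ket ` B (Y \<union> Z)"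
    then obtain a b where ab_in_B: "a \<in> B Y" "b \<in> B Z" and v_eq: "v = ket (merge Y a b)"
      by (auto elim: B_Un_cases)
    have "app Y A (ket a) \<in> rng Y A" "app Z C (ket b) \<in> rng Z C"
      using ab_in_B is_vec_ket by (auto simp: rng_def)
    then show "v \<in> ?T -` K"
      using ab_in_B assms(1) products by (simp add: v_eq app_tensor_tensor_vec flip: tensor_vec_ket)
  qed
  then have "vec.span (ket ` B (Y \<union> Z)) \<subseteq> ?T -` K"
    by (rule vec.span_minimal[OF _ app.subspace_vimage[OF assms(4)]])
  then show ?thesis using vecs_subset_span_ket[of "Y \<union> Z"] assms(2,3) by (auto simp: rng_def)
qed

subsection \<open>Slices\<close>

definition slice_vec :: "nat set \<Rightarrow> asg \<Rightarrow> vec \<Rightarrow> vec" where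
  "slice_vec Y b v = (\<lambda>a. if a \<in> B Y then v (merge Y a b) else 0)"

lemma is_vec_slice_vec [simp]: "is_vec Y (slice_vec Y b v)"
  by (simp add: is_vec_def slice_vec_def)

lemma slice_vec_eqI:
  assumes "is_vec (Y \<union> Z) u" "is_vec (Y \<union> Z) v"
    and "\<And>b. b \<in> B Z \<Longrightarrow> slice_vec Y b u = slice_vec Y b v"
  shows "u = v"
proof (rule vec_eqI[OF assms(1,2)])
  fix f assume "f \<in> B (Y \<union> Z)"
  then obtain a b where f_eq: "a \<in> B Y" "b \<in> B Z" "f = merge Y a b" by (rule B_Un_cases)
  then show "u f = v f" using fun_cong[OF assms(3)[OF f_eq(2)], of a] by (simp add: slice_vec_def)
qed

lemma ip_eq_sum_slice_vec:
  assumes "Y \<inter> Z = {}"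
  shows "ip (Y \<union> Z) u v = (\<Sum>b\<in>B Z. ip Y (slice_vec Y b u) (slice_vec Y b v))"
  unfolding ip_def sum_B_Un[OF assms] by (subst sum.swap) (simp add: slice_vec_def)

lemma slice_vec_app_tensor_idop:
  assumes "Y \<inter> Z = {}" "finite Z" "b \<in> B Z" "is_op Y A"
  shows "slice_vec Y b (app (Y \<union> Z) (tensor Y Z A (idop Z)) v) = app Y A (slice_vec Y b v)"
proof (rule vec_eqI[of Y])
  fix a assume a_in_B: "a \<in> B Y"
  have "app (Y \<union> Z) (tensor Y Z A (idop Z)) v (merge Y a b) =
     (\<Sum>x\<in>B Y. \<Sum>y\<in>B Z. A a x * idop Z b y * v (merge Y x y))"
    unfolding app_def sum_B_Un[OF assms(1)] using assms a_in_B by (simp add: tensor_merge)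
  also have "\<dots> = (\<Sum>x\<in>B Y. \<Sum>y\<in>B Z. if y = b then A a x * v (merge Y x y) else 0)"
    using assms(3) by (intro sum.cong refl) (auto simp: idop_def)
  also have "\<dots> = app Y A (slice_vec Y b v) a"
    using assms by (simp add: finite_B app_def slice_vec_def)
  finally show "slice_vec Y b (app (Y \<union> Z) (tensor Y Z A (idop Z)) v) a =
      app Y A (slice_vec Y b v) a"
    using a_in_B by (simp add: slice_vec_def)
qed (auto simp: assms is_vec_app)

lemma app_tensor_idop_eq_self_iff:
  assumes "Y \<inter> Z = {}" "finite Z" "is_op Y A" "is_vec (Y \<union> Z) v"
  shows "app (Y \<union> Z) (tensor Y Z A (idop Z)) v = v \<longleftrightarrow>
    (\<forall>b\<in>B Z. app Y A (slice_vec Y b v) = slice_vec Y b v)"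
  using slice_vec_eqI[of Y Z "app (Y \<union> Z) (tensor Y Z A (idop Z)) v" v]
    slice_vec_app_tensor_idop[OF assms(1,2) _ assms(3), of _ v] assms(4) is_vec_app[OF is_op_tensor]
  by metis

lemma psd_tensor_idop:
  assumes "Y \<inter> Z = {}" "finite Z" "psd Y A"
  shows "psd (Y \<union> Z) (tensor Y Z A (idop Z))"
proof (rule psdI[OF is_op_tensor])
  fix v
  show "0 \<le> ip (Y \<union> Z) v (app (Y \<union> Z) (tensor Y Z A (idop Z)) v)"
    using assms
    by (simp add: ip_eq_sum_slice_vec slice_vec_app_tensor_idop psd_is_op psd_ip_nonneg sum_nonneg)
qed

subsection \<open>Common fixed spaces\<close>

lemma app_tensor_eq_self_iff:
  assumes "Y \<inter> Z = {}" "finite Y" "finite Z" "is_op Y M" "proj Z R"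
  shows "app (Y \<union> Z) (tensor Y Z M R) v = v \<longleftrightarrow>
    app (Y \<union> Z) (tensor Y Z M (idop Z)) v = v \<and> app (Y \<union> Z) (tensor Y Z (idop Y) R) v = v"
proof -
  have "tensor Y Z M R = mult (Y \<union> Z) (tensor Y Z M (idop Z)) (tensor Y Z (idop Y) R)"
    "tensor Y Z M R = mult (Y \<union> Z) (tensor Y Z (idop Y) R) (tensor Y Z M R)"
    using assms by (simp_all add: mult_tensor mult_idop idop_mult proj_is_op proj_idem)
  then have "app (Y \<union> Z) (tensor Y Z M R) v =
      app (Y \<union> Z) (tensor Y Z M (idop Z)) (app (Y \<union> Z) (tensor Y Z (idop Y) R) v)"
    "app (Y \<union> Z) (tensor Y Z M R) v =
      app (Y \<union> Z) (tensor Y Z (idop Y) R) (app (Y \<union> Z) (tensor Y Z M R) v)"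
    by (simp_all only: flip: app_mult)
  then show ?thesis by metis
qed

definition fixed_space :: "nat set \<Rightarrow> op set \<Rightarrow> vec set" where
  "fixed_space X \<M> = {v. is_vec X v \<and> (\<forall>M\<in>\<M>. app X M v = v)}"

lemma subspace_fixed_space: "vec.subspace (fixed_space X \<M>)"
  by (auto simp: vec.subspace_def fixed_space_def is_vec_def app.add app.scale)

lemma fixed_space_subset_vecs: "fixed_space X \<M> \<subseteq> vecs X"
  by (auto simp: fixed_space_def)

lemma rng_tensor_fixed_space:
  assumes "Y \<inter> Z = {}" "finite Y" "finite Z" "proj Z R" "proj Y A"
    and "\<M> \<noteq> {}" "\<And>M. M \<in> \<M> \<Longrightarrow> is_op Y M" "rng Y A = fixed_space Y \<M>"
  shows "rng (Y \<union> Z) (tensor Y Z A R) = fixed_space (Y \<union> Z) ((\<lambda>M. tensor Y Z M R) ` \<M>)"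
proof -
  have "app (Y \<union> Z) (tensor Y Z A R) v = v \<longleftrightarrow> (\<forall>M\<in>\<M>. app (Y \<union> Z) (tensor Y Z M R) v = v)"
    if v_vec: "is_vec (Y \<union> Z) v" for v
  proof -
    have fixes_tensor_iff: "app (Y \<union> Z) (tensor Y Z M R) v = v \<longleftrightarrow>
        (\<forall>b\<in>B Z. app Y M (slice_vec Y b v) = slice_vec Y b v) \<and>
        app (Y \<union> Z) (tensor Y Z (idop Y) R) v = v" if "is_op Y M" for M
      using app_tensor_eq_self_iff[OF assms(1-3) that assms(4)]
        app_tensor_idop_eq_self_iff[OF assms(1,3) that v_vec] by simp
    have "app Y A u = u \<longleftrightarrow> (\<forall>M\<in>\<M>. app Y M u = u)" if "is_vec Y u" for u
      using that assms(8) by (auto simp: rng_proj[OF assms(5)] fixed_space_def)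
    then show ?thesis
      unfolding fixes_tensor_iff[OF proj_is_op[OF assms(5)]]
      using fixes_tensor_iff[OF assms(7)] assms(6)
      by (simp add: ball_conj_distrib) blast
  qed
  then show ?thesis
    by (auto simp: rng_proj[OF proj_tensor[OF assms(1,5,4)]] fixed_space_def)
qed

subsection \<open>Extension by the identity\<close>

lemma ext_eq_tensor:
  assumes "U \<subseteq> X"
  shows "ext U X A = tensor U (X - U) A (idop (X - U))"
proof (intro ext)
  fix f g
  have union: "U \<union> X = X" using assms by blast
  have "restr (X - U) f = restr (X - U) g \<longleftrightarrow> (\<forall>q\<in>X - U. f q = g q)"
    by (auto simp: restr_def fun_eq_iff)
  then show "Defs.ext U X A f g = tensor U (X - U) A (idop (X - U)) f g"
    by (simp add: ext_def tensor_def union idop_def)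
qed

lemma is_op_ext [simp]: "is_op X (ext U X A)"
  by (simp add: is_op_def ext_def)

lemma ext_self: "is_op X A \<Longrightarrow> ext X X A = A"
  by (auto simp: ext_def is_op_def restr_eq_self fun_eq_iff)

lemma ext_ext:
  assumes "U \<subseteq> Y" "Y \<subseteq> X"
  shows "ext Y X (ext U Y A) = ext U X A"
  using assms by (auto simp: ext_def fun_eq_iff restr_restr) (auto simp: restr_def)

lemma ext_diff: "ext U X (A - C) = ext U X A - ext U X C"
  by (auto simp: ext_def fun_eq_iff)

lemma ext_0 [simp]: "ext U X 0 = 0"
  by (auto simp: ext_def fun_eq_iff)

lemma ext_idop:
  assumes "U \<subseteq> X"
  shows "ext U X (idop U) = idop X"
  using assms by (simp add: ext_eq_tensor tensor_idop Un_absorb1)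

lemma mult_ext:
  assumes "finite X" "U \<subseteq> X"
  shows "mult X (ext U X A) (ext U X C) = ext U X (mult U A C)"
  using assms mult_tensor[of U "X - U" A "idop (X - U)" C "idop (X - U)"]
  by (simp add: ext_eq_tensor idop_mult Un_absorb1)

lemma proj_ext:
  assumes "finite X" "U \<subseteq> X" "proj U P"
  shows "proj X (ext U X P)"
  using assms proj_tensor[of U "X - U" P "idop (X - U)"] by (simp add: ext_eq_tensor Un_absorb1)

lemma psd_ext:
  assumes "finite X" "U \<subseteq> X" "psd U A"
  shows "psd X (ext U X A)"
  using assms psd_tensor_idop[of U "X - U" A] by (simp add: ext_eq_tensor Un_absorb1)

lemma ext_tensor:
  assumes "W \<subseteq> Y" "Y \<inter> Z = {}"
  shows "ext (W \<union> Z) (Y \<union> Z) (tensor W Z Q R) = tensor Y Z (ext W Y Q) R"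
proof (intro ext)
  fix f g
  have "(\<forall>q\<in>Y \<union> Z - (W \<union> Z). f q = g q) \<longleftrightarrow> (\<forall>q\<in>Y - W. restr Y f q = restr Y g q)"
    using assms(2) by (auto simp: restr_def)
  then show "Defs.ext (W \<union> Z) (Y \<union> Z) (tensor W Z Q R) f g = tensor Y Z (Defs.ext W Y Q) R f g"
    using assms(1) by (simp add: ext_def tensor_def restr_restr)
qed

lemma ext_mono:
  assumes "finite X" "U \<subseteq> X" "proj U P" "proj U Q" "psub U P Q"
  shows "psub X (ext U X P) (ext U X Q)"
  using assms finite_subset[OF assms(2,1)] by (simp add: psub_iff_mult_left proj_ext mult_ext)

lemma ext_pmeet:
  assumes "finite X" "U \<subseteq> X" "proj U P" "proj U Q"
  shows "ext U X (pmeet U P Q) = pmeet X (ext U X P) (ext U X Q)"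
proof (rule proj_eqI[OF assms(1)])
  have subregister: "finite U" "U \<union> X = X" using assms(1,2) finite_subset by auto
  note proj_meet = proj_pmeet[OF subregister(1) assms(3,4)]
  show "proj X (ext U X (pmeet U P Q))" by (rule proj_ext[OF assms(1,2) proj_meet])
  show "proj X (pmeet X (ext U X P) (ext U X Q))"
    using assms by (intro proj_pmeet proj_ext)
  have "rng U (pmeet U P Q) = fixed_space U {P, Q}"
    using assms(3,4) by (auto simp: rng_pmeet subregister(1) rng_proj fixed_space_def)
  then have "rng (U \<union> (X - U)) (tensor U (X - U) (pmeet U P Q) (idop (X - U))) =
      fixed_space (U \<union> (X - U)) ((\<lambda>M. tensor U (X - U) M (idop (X - U))) ` {P, Q})"
    using assms(1,3,4) subregister(1) proj_meet
    by (intro rng_tensor_fixed_space) (auto intro: proj_is_op)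
  then have "rng X (ext U X (pmeet U P Q)) = fixed_space X {ext U X P, ext U X Q}"
    by (simp add: ext_eq_tensor assms(2) subregister(2))
  also have "\<dots> = rng X (pmeet X (ext U X P) (ext U X Q))"
    using assms by (auto simp: rng_pmeet proj_ext rng_proj fixed_space_def)
  finally show "rng X (ext U X (pmeet U P Q)) = rng X (pmeet X (ext U X P) (ext U X Q))" .
qed

lemma ext_pjoin:
  assumes "finite X" "U \<subseteq> X" "proj U P" "proj U Q"
  shows "ext U X (pjoin U P Q) = pjoin X (ext U X P) (ext U X Q)"
proof -
  have "finite U" using assms finite_subset by blast
  then show ?thesis
    using assms by (simp add: pjoin_eq_compl_pmeet proj_ext ext_diff ext_idop ext_pmeet proj_compl)
qed

section \<open>Super-operators and their duals\<close>

definition linear_sop :: "nat set \<Rightarrow> sop \<Rightarrow> bool" where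
  "linear_sop X F \<longleftrightarrow>
     (\<forall>A. is_op X A \<longrightarrow> is_op X (F A)) \<and>
     (\<forall>A C. is_op X A \<longrightarrow> is_op X C \<longrightarrow> F (A + C) = F A + F C) \<and>
     (\<forall>A c. is_op X A \<longrightarrow> F (\<lambda>f g. c * A f g) = (\<lambda>f g. c * F A f g))"

lemma linear_sop_add: "linear_sop X F \<Longrightarrow> is_op X A \<Longrightarrow> is_op X C \<Longrightarrow> F (A + C) = F A + F C"
  by (simp add: linear_sop_def)

lemma linear_sop_scale: "linear_sop X F \<Longrightarrow> is_op X A \<Longrightarrow> F (\<lambda>f g. c * A f g) = (\<lambda>f g. c * F A f g)"
  by (simp add: linear_sop_def)

lemma linear_sop_0: "linear_sop X F \<Longrightarrow> F 0 = 0"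
  using linear_sop_add[of X F 0 0] by simp

lemma linear_sop_sum:
  assumes "linear_sop X F" "\<And>i. i \<in> I \<Longrightarrow> is_op X (A i)"
  shows "F (\<Sum>i\<in>I. (\<lambda>f g. c i * A i f g)) = (\<Sum>i\<in>I. (\<lambda>f g. c i * F (A i) f g))"
  using assms(2)
proof (induction I rule: infinite_finite_induct)
  case (insert i I)
  have ops: "is_op X (\<lambda>f g. c i * A i f g)" "is_op X (\<Sum>i\<in>I. (\<lambda>f g. c i * A i f g))" "is_op X (A i)"
    using insert.prems by (auto simp: is_op_def sum_fun_apply)
  have "F (\<Sum>i\<in>I. (\<lambda>f g. c i * A i f g)) = (\<Sum>i\<in>I. (\<lambda>f g. c i * F (A i) f g))"
    using insert by blast
  then show ?case
    using ops
    by (simp only: sum.insert[OF insert.hyps] linear_sop_add[OF assms(1)]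
        linear_sop_scale[OF assms(1)])
qed (simp_all add: linear_sop_0[OF assms(1)])

lemma op_eq_sum_outer_ket:
  assumes "finite X" "is_op X A"
  shows "A = (\<Sum>(f, g)\<in>B X \<times> B X. (\<lambda>h k. A f g * outer (ket f) (ket g) h k))"
proof (rule op_eqI[OF assms(2)])
  show "is_op X (\<Sum>(f, g)\<in>B X \<times> B X. (\<lambda>h k. A f g * outer (ket f) (ket g) h k))"
    by (auto simp: is_op_def sum_fun_apply outer_def ket_def case_prod_unfold intro!: sum.neutral)
next
  fix h k assume hk_in_B: "h \<in> B X" "k \<in> B X"
  have "(\<Sum>(f, g)\<in>B X \<times> B X. (\<lambda>h k. A f g * outer (ket f) (ket g) h k)) h k =
      (\<Sum>p\<in>B X \<times> B X. if p = (h, k) then A h k else 0)"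
    unfolding sum_fun_apply by (intro sum.cong) (auto simp: outer_def ket_def)
  also have "\<dots> = A h k" using hk_in_B assms(1) by (simp add: finite_B)
  finally show "A h k = (\<Sum>(f, g)\<in>B X \<times> B X. (\<lambda>h k. A f g * outer (ket f) (ket g) h k)) h k" ..
qed

lemma tr_mult_sum:
  "tr X (mult X A (\<Sum>i\<in>I. (\<lambda>f g. c i * C i f g))) = (\<Sum>i\<in>I. c i * tr X (mult X A (C i)))"
proof -
  have "tr X (mult X A (\<lambda>f g. c * C f g)) = c * tr X (mult X A C)" for c and C :: op
    by (simp add: tr_def mult_def sum_distrib_left mult_ac)
  moreover have "tr X (mult X A 0) = 0" by (simp add: tr_def mult_def)
  ultimately show ?thesis
    by (induction I rule: infinite_finite_induct)
      (simp_all add: mult_add_right tr_add del: mult_0_right)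
qed

definition dual :: "nat set \<Rightarrow> sop \<Rightarrow> sop" where
  "dual X F A = (\<lambda>f g. if f \<in> B X \<and> g \<in> B X
     then tr X (mult X A (F (outer (ket g) (ket f)))) else 0)"

lemma is_op_dual [simp]: "is_op X (dual X F A)"
  by (auto simp: is_op_def dual_def)

lemma dual_0 [simp]: "dual X F 0 = 0"
  by (auto simp: dual_def fun_eq_iff tr_def)

lemma dual_diff: "dual X F (A - C) = dual X F A - dual X F C"
  by (auto simp: dual_def fun_eq_iff mult_diff_left tr_diff)

lemma tr_dual:
  assumes "finite X" "linear_sop X F" "is_op X \<rho>"
  shows "tr X (mult X (dual X F A) \<rho>) = tr X (mult X A (F \<rho>))"
proof -
  let ?u = "\<lambda>(f, g). outer (ket f) (ket g)"
  have \<rho>_eq: "\<rho> = (\<Sum>p\<in>B X \<times> B X. (\<lambda>h k. case_prod \<rho> p * ?u p h k))"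
    using op_eq_sum_outer_ket[OF assms(1,3)] unfolding case_prod_unfold .
  have is_op_u: "is_op X (?u p)" if "p \<in> B X \<times> B X" for p
    using that by (auto simp: is_op_outer is_vec_ket)
  have "tr X (mult X (dual X F A) \<rho>) =
      (\<Sum>p\<in>B X \<times> B X. case_prod \<rho> p * tr X (mult X (dual X F A) (?u p)))"
    by (subst \<rho>_eq) (rule tr_mult_sum)
  also have "\<dots> = (\<Sum>p\<in>B X \<times> B X. case_prod \<rho> p * tr X (mult X A (F (?u p))))"
    using assms(1) by (intro sum.cong refl) (auto simp: tr_mult_outer app_ket ip_ket dual_def)
  also have "\<dots> = tr X (mult X A (F \<rho>))"
    by (subst \<rho>_eq) (simp only: linear_sop_sum[OF assms(2) is_op_u] tr_mult_sum)
  finally show ?thesis .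
qed

definition subchannel :: "nat set \<Rightarrow> sop \<Rightarrow> bool" where
  "subchannel X F \<longleftrightarrow> linear_sop X F \<and> (\<forall>\<rho>. psd X \<rho> \<longrightarrow> psd X (F \<rho>) \<and> tr X (F \<rho>) \<le> tr X \<rho>)"

definition effect :: "nat set \<Rightarrow> op \<Rightarrow> bool" where
  "effect X M \<longleftrightarrow> psd X M \<and> psd X (idop X - M)"

lemma effect_compl: "effect X M \<Longrightarrow> effect X (idop X - M)"
  by (simp add: effect_def)

lemma effect_proj: "finite X \<Longrightarrow> proj X P \<Longrightarrow> effect X P"
  by (simp add: effect_def psd_proj proj_compl)

lemma effect_ext:
  assumes "finite X" "U \<subseteq> X" "effect U M"
  shows "effect X (ext U X M)"
proof -
  have "ext U X (idop U - M) = idop X - ext U X M" by (simp add: ext_diff ext_idop assms(2))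
  then show ?thesis
    using assms(3) psd_ext[OF assms(1,2), of M] psd_ext[OF assms(1,2), of "idop U - M"]
    by (simp add: effect_def)
qed

lemma subchannel_psd: "subchannel X F \<Longrightarrow> psd X \<rho> \<Longrightarrow> psd X (F \<rho>)"
  by (simp add: subchannel_def)

lemma tr_dual_subchannel:
  "finite X \<Longrightarrow> subchannel X F \<Longrightarrow> psd X \<rho> \<Longrightarrow> tr X (mult X (dual X F A) \<rho>) = tr X (mult X A (F \<rho>))"
  by (simp add: subchannel_def tr_dual psd_is_op)

lemma ip_dual:
  assumes "finite X" "subchannel X F" "is_vec X v"
  shows "ip X v (app X (dual X F A) v) = tr X (mult X A (F (outer v v)))"
  using tr_dual_subchannel[OF assms(1,2) psd_outer[OF assms(3)], of A] by (simp add: tr_mult_outer)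

lemma psd_dual:
  assumes "finite X" "subchannel X F" "psd X A"
  shows "psd X (dual X F A)"
proof (rule psdI[OF is_op_dual])
  fix v assume v_vec: "is_vec X v"
  have "0 \<le> tr X (mult X A (F (outer v v)))"
    by (rule tr_mult_psd_nonneg[OF assms(1,3) subchannel_psd[OF assms(2) psd_outer[OF v_vec]]])
  then show "0 \<le> ip X v (app X (dual X F A) v)" by (simp only: ip_dual[OF assms(1,2) v_vec])
qed

lemma psd_compl_dual_idop:
  assumes "finite X" "subchannel X F"
  shows "psd X (idop X - dual X F (idop X))"
proof (rule psdI)
  fix v assume v_vec: "is_vec X v"
  have "is_op X (F (outer v v))"
    using subchannel_psd[OF assms(2) psd_outer[OF v_vec]] by (rule psd_is_op)
  then have "ip X v (app X (dual X F (idop X)) v) = tr X (F (outer v v))"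
    by (simp add: ip_dual assms v_vec idop_mult)
  also have "\<dots> \<le> tr X (outer v v)" using assms(2) psd_outer[OF v_vec] by (simp add: subchannel_def)
  finally have "ip X v (app X (dual X F (idop X)) v) \<le> ip X v v" by (simp only: tr_outer)
  then show "0 \<le> ip X v (app X (idop X - dual X F (idop X)) v)"
    by (simp add: app_diff_left ip_diff_right app_idop assms(1) v_vec)
qed (simp add: is_op_diff)

lemma effect_dual:
  assumes "finite X" "subchannel X F" "effect X A"
  shows "effect X (dual X F A)"
proof -
  have "psd X ((idop X - dual X F (idop X)) + dual X F (idop X - A))"
    using assms by (intro psd_add psd_compl_dual_idop psd_dual) (simp_all add: effect_def)
  moreover have "(idop X - dual X F (idop X)) + dual X F (idop X - A) = idop X - dual X F A"
    by (simp add: dual_diff)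
  ultimately show ?thesis using assms by (simp add: effect_def psd_dual)
qed

subsection \<open>Extension of super-operators\<close>

definition slice_op :: "nat set \<Rightarrow> asg \<Rightarrow> asg \<Rightarrow> op \<Rightarrow> op" where
  "slice_op V b d A = (\<lambda>a c. if a \<in> B V \<and> c \<in> B V then A (merge V a b) (merge V c d) else 0)"

lemma is_op_slice_op [simp]: "is_op V (slice_op V b d A)"
  by (auto simp: is_op_def slice_op_def)

lemma slice_op_add: "slice_op V b d (A + C) = slice_op V b d A + slice_op V b d C"
  by (simp add: slice_op_def fun_eq_iff)

lemma slice_op_scale: "slice_op V b d (\<lambda>f g. c * A f g) = (\<lambda>f g. c * slice_op V b d A f g)"
  by (simp add: slice_op_def fun_eq_iff)

lemma sext_eq:
  "sext V X E \<rho> f g =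
    (if f \<in> B X \<and> g \<in> B X then E (slice_op V f g \<rho>) (restr V f) (restr V g) else 0)"
  by (simp add: sext_def slice_op_def)

lemma is_op_sext [simp]: "is_op X (sext V X E \<rho>)"
  by (auto simp: is_op_def sext_eq)

lemma DProg_scale: "DProg V E \<Longrightarrow> is_op V A \<Longrightarrow> E (\<lambda>f g. c * A f g) = (\<lambda>f g. c * E A f g)"
  by (simp add: DProg_def)

lemma DProg_add: "DProg V E \<Longrightarrow> is_op V A \<Longrightarrow> is_op V C \<Longrightarrow> E (A + C) = E A + E C"
  by (simp add: DProg_def plus_fun_def)

lemma linear_sop_sext:
  assumes "DProg V E"
  shows "linear_sop X (sext V X E)"
  unfolding linear_sop_def
  by (intro conjI allI impI ext)
    (simp_all add: sext_eq slice_op_add slice_op_scale DProg_add[OF assms] DProg_scale[OF assms])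

lemma sext_self:
  assumes "DProg V E" "is_op V A"
  shows "sext V V E A = E A"
proof (rule op_eqI[of V])
  have "merge V a f = a" if "a \<in> B V" "f \<in> B V" for a f
    using that by (auto simp: merge_def B_def fun_eq_iff)
  then have "slice_op V f g A = A" if "f \<in> B V" "g \<in> B V" for f g
    using that by (intro op_eqI[OF is_op_slice_op assms(2)]) (simp add: slice_op_def)
  then show "sext V V E A f g = E A f g" if "f \<in> B V" "g \<in> B V" for f g
    using that by (simp add: sext_eq restr_eq_self)
qed (use assms(1) in \<open>auto simp: DProg_def\<close>)

lemma sext_tensor:
  assumes "V \<subseteq> Y" "Y \<inter> Z = {}" "DProg V E"
  shows "sext V (Y \<union> Z) E (tensor Y Z A C) = tensor Y Z (sext V Y E A) C"
proof (rule op_eqI[of "Y \<union> Z"])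
  fix f g assume fg_in_B: "f \<in> B (Y \<union> Z)" "g \<in> B (Y \<union> Z)"
  have "merge V a h \<in> B (Y \<union> Z)" "restr Y (merge V a h) = merge V a (restr Y h)"
    "restr Z (merge V a h) = restr Z h" if "a \<in> B V" "h \<in> B (Y \<union> Z)" for a h
    using that assms(1,2) by (auto simp: B_def merge_def restr_def fun_eq_iff)
  then have "slice_op V f g (tensor Y Z A C) =
      (\<lambda>a c. C (restr Z f) (restr Z g) * slice_op V (restr Y f) (restr Y g) A a c)"
    using fg_in_B by (intro ext) (simp add: slice_op_def tensor_def mult.commute)
  then have "E (slice_op V f g (tensor Y Z A C)) =
      (\<lambda>a c. C (restr Z f) (restr Z g) * E (slice_op V (restr Y f) (restr Y g) A) a c)"
    by (simp add: DProg_scale[OF assms(3)])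
  then show "sext V (Y \<union> Z) E (tensor Y Z A C) f g = tensor Y Z (sext V Y E A) C f g"
    using fg_in_B assms(1) by (simp add: sext_eq tensor_def restr_restr mult.commute)
qed auto

lemma dual_sext_tensor:
  assumes "V \<subseteq> Y" "Y \<inter> Z = {}" "finite Z" "DProg V E"
  shows "dual (Y \<union> Z) (sext V (Y \<union> Z) E) (tensor Y Z A C) = tensor Y Z (dual Y (sext V Y E) A) C"
proof (rule op_eqI[of "Y \<union> Z"])
  fix f g assume "f \<in> B (Y \<union> Z)" "g \<in> B (Y \<union> Z)"
  then obtain a b a' b' where fg_eq: "a \<in> B Y" "b \<in> B Z" "f = merge Y a b"
     "a' \<in> B Y" "b' \<in> B Z" "g = merge Y a' b'" by (metis B_Un_cases)
  have "sext V (Y \<union> Z) E (outer (ket g) (ket f)) =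
      tensor Y Z (sext V Y E (outer (ket a') (ket a))) (outer (ket b') (ket b))"
    using fg_eq assms by (simp add: outer_tensor_vec sext_tensor flip: tensor_vec_ket)
  then have "dual (Y \<union> Z) (sext V (Y \<union> Z) E) (tensor Y Z A C) f g =
      tr Y (mult Y A (sext V Y E (outer (ket a') (ket a)))) *
      tr Z (mult Z C (outer (ket b') (ket b)))"
    using fg_eq by (simp add: dual_def merge_in_B mult_tensor tr_tensor assms(2))
  also have "\<dots> = tensor Y Z (dual Y (sext V Y E) A) C f g"
    using fg_eq by (simp add: tensor_merge assms(2,3) dual_def tr_mult_outer ip_ket app_ket)
  finally show "dual (Y \<union> Z) (sext V (Y \<union> Z) E) (tensor Y Z A C) f g =
    tensor Y Z (dual Y (sext V Y E) A) C f g" .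
qed auto

lemma dual_sext_ext:
  assumes "V \<subseteq> Y" "Y \<subseteq> X" "finite X" "DProg V E"
  shows "dual X (sext V X E) (ext Y X A) = ext Y X (dual Y (sext V Y E) A)"
  using assms dual_sext_tensor[of V Y "X - Y" E A "idop (X - Y)"]
  by (simp add: ext_eq_tensor Un_absorb1)

lemma subchannel_sext_self:
  assumes "finite V" "DProg V E"
  shows "subchannel V (sext V V E)"
proof -
  have "tr V (sext V V E \<rho>) \<le> tr V \<rho>" "psd V (sext V V E \<rho>)" if psd_\<rho>: "psd V \<rho>" for \<rho>
  proof -
    show psd_E_\<rho>: "psd V (sext V V E \<rho>)" using assms psd_\<rho> by (auto simp: DProg_def)
    have "Re (tr V (sext V V E \<rho>)) \<le> Re (tr V \<rho>)"
      using assms(2) psd_\<rho> by (simp add: sext_self psd_is_op) (simp add: DProg_def)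
    then show "tr V (sext V V E \<rho>) \<le> tr V \<rho>"
      using tr_psd_nonneg[OF assms(1) psd_\<rho>] tr_psd_nonneg[OF assms(1) psd_E_\<rho>]
      by (simp add: less_eq_complex_def)
  qed
  then show ?thesis using linear_sop_sext[OF assms(2)] by (simp add: subchannel_def)
qed

lemma subchannel_sext:
  assumes "finite X" "V \<subseteq> X" "DProg V E"
  shows "subchannel X (sext V X E)"
proof -
  have fin_V: "finite V" using assms(1,2) finite_subset by blast
  have "tr X (sext V X E \<rho>) \<le> tr X \<rho>" if psd_\<rho>: "psd X \<rho>" for \<rho>
  proof -
    define D where "D = dual X (sext V X E) (idop X)"
    have "D = ext V X (dual V (sext V V E) (idop V))"
      using dual_sext_ext[of V V X E "idop V"] assms by (simp add: D_def ext_idop)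
    then have "effect X D"
      using effect_ext[OF assms(1,2)] effect_dual[OF fin_V subchannel_sext_self[OF fin_V assms(3)]]
        effect_proj[OF fin_V proj_idop[OF fin_V]] by simp
    then have "0 \<le> tr X (mult X (idop X - D) \<rho>)"
      using tr_mult_psd_nonneg[OF assms(1) _ psd_\<rho>] by (simp add: effect_def)
    moreover have "tr X (mult X D \<rho>) = tr X (sext V X E \<rho>)"
      using assms psd_\<rho> by (simp add: D_def tr_dual linear_sop_sext psd_is_op idop_mult)
    ultimately show ?thesis
      using assms(1) psd_\<rho> by (simp add: mult_diff_left tr_diff idop_mult psd_is_op)
  qed
  moreover have "psd X (sext V X E \<rho>)" if "psd X \<rho>" for \<rho>
    using that assms by (simp add: DProg_def)
  ultimately show ?thesis using linear_sop_sext[OF assms(3)] by (simp add: subchannel_def)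
qed

section \<open>Comparing projectors with effects\<close>

lemma psd_diff_iff_density:
  assumes "finite X" "psd X A" "psd X C"
  shows "psd X (C - A) \<longleftrightarrow>
    (\<forall>\<rho>. density X \<rho> \<longrightarrow> Re (tr X (mult X A \<rho>)) \<le> Re (tr X (mult X C \<rho>)))"
proof
  assume psd_diff: "psd X (C - A)"
  show "\<forall>\<rho>. density X \<rho> \<longrightarrow> Re (tr X (mult X A \<rho>)) \<le> Re (tr X (mult X C \<rho>))"
  proof (intro allI impI)
    fix \<rho> assume "density X \<rho>"
    then have "0 \<le> tr X (mult X (C - A) \<rho>)"
      by (intro tr_mult_psd_nonneg[OF assms(1) psd_diff]) (simp add: density_def)
    then show "Re (tr X (mult X A \<rho>)) \<le> Re (tr X (mult X C \<rho>))"
      by (simp add: mult_diff_left tr_diff less_eq_complex_def)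
  qed
next
  assume tr_le: "\<forall>\<rho>. density X \<rho> \<longrightarrow> Re (tr X (mult X A \<rho>)) \<le> Re (tr X (mult X C \<rho>))"
  show "psd X (C - A)"
  proof (rule psdI)
    fix v assume v_vec: "is_vec X v"
    show "0 \<le> ip X v (app X (C - A) v)"
    proof (cases "v = 0")
      case False
      obtain c where normalized: "c \<noteq> 0" "ip X (\<lambda>f. c * v f) (\<lambda>f. c * v f) = 1"
        using ex_unit_multiple[OF assms(1) v_vec False] .
      define u where "u = (\<lambda>f. c * v f)"
      have "density X (outer u u)"
        using v_vec normalized(2) by (simp add: density_def u_def psd_outer is_vec_def tr_outer)
      then have "Re (ip X u (app X A u)) \<le> Re (ip X u (app X C u))"
        using tr_le tr_mult_outer by metis
      then have "0 \<le> ip X u (app X (C - A) u)"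
        using psd_ip_nonneg[OF assms(2), of u] psd_ip_nonneg[OF assms(3), of u]
        by (simp add: app_diff_left ip_diff_right less_eq_complex_def)
      also have "\<dots> = complex_of_real ((cmod c)\<^sup>2) * ip X v (app X (C - A) v)"
        by (simp add: u_def app.scale ip_scale_left ip_scale_right complex_norm_square
            del: of_real_power)
      finally show ?thesis using normalized(1) by (simp add: less_eq_complex_def zero_le_mult_iff)
    qed simp
  qed (use assms psd_is_op is_op_diff in blast)
qed

lemma psd_diff_proj_iff:
  assumes "finite X" "effect X M" "proj X P"
  shows "psd X (M - P) \<longleftrightarrow> (\<forall>v\<in>rng X P. app X M v = v)"
proof
  assume psd_diff: "psd X (M - P)"
  show "\<forall>v\<in>rng X P. app X M v = v"
  proof
    fix v assume "v \<in> rng X P"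
    then have fixed_by_P: "is_vec X v" "app X P v = v" using assms(3) by (auto simp: rng_proj)
    have psd_compl: "psd X (idop X - M)" using assms(2) by (simp add: effect_def)
    have "0 \<le> ip X v (app X M v) - ip X v v"
      using psd_ip_nonneg[OF psd_diff, of v] by (simp add: app_diff_left ip_diff_right fixed_by_P)
    moreover have "ip X v (app X (idop X - M) v) = ip X v v - ip X v (app X M v)"
      by (simp add: app_diff_left ip_diff_right app_idop assms(1) fixed_by_P(1))
    moreover have "0 \<le> ip X v (app X (idop X - M) v)" by (rule psd_ip_nonneg[OF psd_compl])
    ultimately have "ip X v (app X (idop X - M) v) = 0"
      by (metis diff_ge_0_iff_ge order_antisym right_minus_eq)
    then show "app X M v = v"
      using psd_app_eq_0[OF assms(1) psd_compl] app_compl_eq_0_iff[OF assms(1) fixed_by_P(1)]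
      by blast
  qed
next
  assume fixes_rng: "\<forall>v\<in>rng X P. app X M v = v"
  have M_psd: "psd X M" "is_op X M" "adj M = M"
    using assms by (auto simp: effect_def psd_is_op psd_adj)
  have compl: "proj X (idop X - P)" by (rule proj_compl[OF assms(1,3)])
  have mult_M_P: "mult X M P = P"
    using fixes_rng by (simp add: mult_eq_self_iff_fixes_rng assms(1) M_psd(2)
        proj_is_op[OF assms(3)])
  then have mult_P_M: "mult X P M = P"
    using adj_mult[of X M P] by (simp add: M_psd(3) proj_adj[OF assms(3)])
  have "mult X (idop X - P) (mult X M (idop X - P)) = M - P"
    using assms(1,3) M_psd(2)
    by (simp add: mult_diff_left mult_diff_right mult_idop idop_mult mult_M_P mult_P_M
        is_op_diff proj_is_op proj_idem)
  then show "psd X (M - P)"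
    using psd_conj[OF M_psd(1) proj_is_op[OF compl]] by (simp add: proj_adj[OF compl])
qed

lemma density_le_INF_iff:
  assumes "finite Y" "U \<subseteq> Y" "I \<noteq> {}" "proj U P" "\<And>i. i \<in> I \<Longrightarrow> effect Y (M i)"
    and obs_eq: "\<And>X \<rho> i. finite X \<Longrightarrow> Y \<subseteq> X \<Longrightarrow> density X \<rho> \<Longrightarrow> i \<in> I \<Longrightarrow>
      obs X \<rho> i = Re (tr X (mult X (ext Y X (M i)) \<rho>))"
  shows "(\<forall>X \<rho>. finite X \<and> Y \<subseteq> X \<and> density X \<rho> \<longrightarrow>
      Re (tr X (mult X (ext U X P) \<rho>)) \<le> (INF i\<in>I. obs X \<rho> i)) \<longleftrightarrow>
    rng Y (ext U Y P) \<subseteq> fixed_space Y (M ` I)" (is "?le \<longleftrightarrow> _")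
proof -
  let ?P = "ext U Y P"
  have proj_P: "proj Y ?P" by (rule proj_ext[OF assms(1,2,4)])
  then have psd_P: "psd Y ?P" by (rule psd_proj[OF assms(1)])
  have psd_M: "psd Y (M i)" if "i \<in> I" for i using assms(5)[OF that] by (simp add: effect_def)
  have ext_self_diff: "ext Y Y (M i - ?P) = M i - ?P" if "i \<in> I" for i
    using psd_M[OF that] by (simp add: ext_self is_op_diff psd_is_op)
  have le_INF: "a \<le> (INF i\<in>I. obs X \<rho> i) \<longleftrightarrow> (\<forall>i\<in>I. a \<le> Re (tr X (mult X (ext Y X (M i)) \<rho>)))"
    if X_\<rho>: "finite X" "Y \<subseteq> X" "density X \<rho>" for a X \<rho>
  proof -
    have "0 \<le> obs X \<rho> i" if "i \<in> I" for i
      using tr_mult_psd_nonneg[OF X_\<rho>(1) psd_ext[OF X_\<rho>(1,2) psd_M[OF that]], of \<rho>] X_\<rho>(3)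
      by (simp add: obs_eq[OF X_\<rho> that] density_def less_eq_complex_def)
    then have "bdd_below ((\<lambda>i. obs X \<rho> i) ` I)" by (rule bdd_belowI2)
    then show ?thesis using le_cINF_iff[OF assms(3)] obs_eq[OF X_\<rho>] by simp
  qed
  have "?le \<longleftrightarrow> (\<forall>i\<in>I. \<forall>X. finite X \<and> Y \<subseteq> X \<longrightarrow> (\<forall>\<rho>. density X \<rho> \<longrightarrow>
      Re (tr X (mult X (ext Y X ?P) \<rho>)) \<le> Re (tr X (mult X (ext Y X (M i)) \<rho>))))"
    by (auto simp: le_INF ext_ext assms(2))
  also have "\<dots> \<longleftrightarrow> (\<forall>i\<in>I. \<forall>X. finite X \<and> Y \<subseteq> X \<longrightarrow> psd X (ext Y X (M i - ?P)))"
    using psd_P psd_M by (simp add: ext_diff psd_diff_iff_density psd_ext)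
  also have "\<dots> \<longleftrightarrow> (\<forall>i\<in>I. psd Y (M i - ?P))"
    using assms(1) psd_ext ext_self_diff by (intro ball_cong refl) (metis order_refl)
  also have "\<dots> \<longleftrightarrow> rng Y ?P \<subseteq> fixed_space Y (M ` I)"
    using assms(5) rng_subset_vecs[OF proj_is_op[OF proj_P]]
    by (auto simp: psd_diff_proj_iff[OF assms(1) _ proj_P] fixed_space_def)
  finally show ?thesis .
qed

section \<open>Predicate transformers of a family of super-operators\<close>

definition ldual :: "nat set \<Rightarrow> sop \<Rightarrow> sop" where
  "ldual X F A = idop X - dual X F (idop X - A)"

definition wp_space :: "nat set \<Rightarrow> sop set \<Rightarrow> op \<Rightarrow> vec set" where
  "wp_space X \<F> Q = fixed_space X ((\<lambda>F. dual X F Q) ` \<F>)"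

definition wlp_space :: "nat set \<Rightarrow> sop set \<Rightarrow> op \<Rightarrow> vec set" where
  "wlp_space X \<F> Q = fixed_space X ((\<lambda>F. ldual X F Q) ` \<F>)"

definition sp_space :: "nat set \<Rightarrow> sop set \<Rightarrow> op \<Rightarrow> vec set" where
  "sp_space X \<F> P = vec.span (\<Union>F\<in>\<F>. \<Union>v\<in>rng X P. rng X (F (outer v v)))"

lemma effect_ldual:
  "finite X \<Longrightarrow> subchannel X F \<Longrightarrow> effect X A \<Longrightarrow> effect X (ldual X F A)"
  by (simp add: ldual_def effect_compl effect_dual)

lemma tr_ldual:
  assumes "finite X" "linear_sop X F" "is_op X \<rho>"
  shows "tr X (mult X (ldual X F A) \<rho>) = tr X (mult X A (F \<rho>)) + tr X \<rho> - tr X (F \<rho>)"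
proof -
  have "is_op X (F \<rho>)" using assms(2,3) by (simp add: linear_sop_def)
  then show ?thesis
    using assms by (simp add: ldual_def mult_diff_left tr_diff tr_dual idop_mult)
qed

lemma app_ldual_eq_self_iff:
  assumes "finite X" "is_vec X v"
  shows "app X (ldual X F A) v = v \<longleftrightarrow> app X (dual X F (idop X - A)) v = 0"
  using app_compl_eq_0_iff[OF assms, of "idop X - dual X F (idop X - A)"] by (simp add: ldual_def)

lemma app_ldual_eq_self_iff_rng:
  assumes "finite X" "subchannel X F" "proj X Q" "is_vec X v"
  shows "app X (ldual X F Q) v = v \<longleftrightarrow> rng X (F (outer v v)) \<subseteq> rng X Q"
proof -
  define D where "D = F (outer v v)"
  have psd_D: "psd X D" unfolding D_def by (rule subchannel_psd[OF assms(2) psd_outer[OF assms(4)]])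
  have psd_compl: "psd X (idop X - Q)" using assms by (simp add: psd_proj proj_compl)
  have "app X (ldual X F Q) v = v \<longleftrightarrow> app X (dual X F (idop X - Q)) v = 0"
    by (rule app_ldual_eq_self_iff[OF assms(1,4)])
  also have "\<dots> \<longleftrightarrow> ip X v (app X (dual X F (idop X - Q)) v) = 0"
    using psd_app_eq_0[OF assms(1) psd_dual[OF assms(1,2) psd_compl]] by auto
  also have "\<dots> \<longleftrightarrow> tr X (mult X (idop X - Q) D) = 0"
    by (simp only: ip_dual[OF assms(1,2,4)] D_def)
  also have "\<dots> \<longleftrightarrow> mult X (idop X - Q) D = 0"
    using psd_mult_eq_0[OF assms(1) psd_compl psd_D] by (auto simp: tr_def)
  also have "\<dots> \<longleftrightarrow> mult X Q D = D"
    using assms(1) psd_is_op[OF psd_D] by (auto simp: mult_diff_left idop_mult)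
  also have "\<dots> \<longleftrightarrow> rng X D \<subseteq> rng X Q"
    using rng_subset_proj_iff[OF assms(1) psd_is_op[OF psd_D] assms(3)] by simp
  finally show ?thesis by (simp only: D_def)
qed

lemma mem_wlp_space_iff:
  assumes "finite X" "\<forall>F\<in>\<F>. subchannel X F" "proj X Q"
  shows "v \<in> wlp_space X \<F> Q \<longleftrightarrow> is_vec X v \<and> (\<forall>F\<in>\<F>. rng X (F (outer v v)) \<subseteq> rng X Q)"
proof -
  have "app X (ldual X F Q) v = v \<longleftrightarrow> rng X (F (outer v v)) \<subseteq> rng X Q"
    if "F \<in> \<F>" "is_vec X v" for F
    by (rule app_ldual_eq_self_iff_rng[OF assms(1) bspec[OF assms(2) that(1)] assms(3) that(2)])
  then show ?thesis by (auto simp: wlp_space_def fixed_space_def)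
qed

lemma sp_space_subset_iff:
  assumes "finite X" "\<forall>F\<in>\<F>. subchannel X F" "proj X P" "proj X R"
  shows "sp_space X \<F> P \<subseteq> rng X R \<longleftrightarrow> rng X P \<subseteq> wlp_space X \<F> R"
proof -
  have "sp_space X \<F> P \<subseteq> rng X R \<longleftrightarrow> (\<Union>F\<in>\<F>. \<Union>v\<in>rng X P. rng X (F (outer v v))) \<subseteq> rng X R"
    unfolding sp_space_def using vec.span_minimal[OF _ subspace_rng] vec.span_superset
    by (metis (no_types, lifting) order_trans)
  also have "\<dots> \<longleftrightarrow> rng X P \<subseteq> wlp_space X \<F> R"
    using mem_wlp_space_iff[OF assms(1,2,4)] by (simp add: subset_iff rng_proj[OF assms(3)]) blast
  finally show ?thesis .
qed

lemma sp_space_subset_vecs: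
  assumes "\<forall>F\<in>\<F>. subchannel X F" "proj X P"
  shows "sp_space X \<F> P \<subseteq> vecs X"
proof -
  have "rng X (F (outer v v)) \<subseteq> vecs X" if "F \<in> \<F>" "v \<in> rng X P" for F v
    using that assms
    by (intro rng_subset_vecs psd_is_op subchannel_psd[of X F]) (auto simp: psd_outer rng_proj)
  then show ?thesis
    unfolding sp_space_def by (intro vec.span_minimal subspace_vecs) blast
qed

lemma wlp_space_mono:
  assumes "finite X" "\<forall>F\<in>\<F>. subchannel X F" "proj X P" "proj X Q" "psub X P Q"
  shows "wlp_space X \<F> P \<subseteq> wlp_space X \<F> Q"
  using assms(5) mem_wlp_space_iff[OF assms(1,2,3)] mem_wlp_space_iff[OF assms(1,2,4)]
  by (auto simp: psub_def) blast

lemma wlp_space_pmeet: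
  assumes "finite X" "\<forall>F\<in>\<F>. subchannel X F" "proj X P" "proj X Q"
  shows "wlp_space X \<F> (pmeet X P Q) = wlp_space X \<F> P \<inter> wlp_space X \<F> Q"
  using mem_wlp_space_iff[OF assms(1,2,3)] mem_wlp_space_iff[OF assms(1,2,4)]
    mem_wlp_space_iff[OF assms(1,2) proj_pmeet[OF assms(1,3,4)]]
  by (auto simp: rng_pmeet[OF assms(1,3,4)])

lemma wlp_space_idop: "finite X \<Longrightarrow> wlp_space X \<F> (idop X) = vecs X"
  by (auto simp: wlp_space_def fixed_space_def ldual_def app_idop)

lemma wp_space_0: "\<F> \<noteq> {} \<Longrightarrow> wp_space X \<F> 0 = {0}"
  by (auto simp: wp_space_def fixed_space_def)

lemma wp_space_eq_wlp_space_Int: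
  assumes "finite X" "\<forall>F\<in>\<F>. subchannel X F" "proj X Q"
  shows "wp_space X \<F> Q = wlp_space X \<F> Q \<inter> wp_space X \<F> (idop X)"
proof -
  have "app X (dual X F Q) v = v \<longleftrightarrow> app X (ldual X F Q) v = v \<and> app X (dual X F (idop X)) v = v"
    if F_in: "F \<in> \<F>" and v_vec: "is_vec X v" for F v
  proof -
    have "psd X (dual X F (idop X - Q))" "psd X (idop X - dual X F (idop X))"
      using bspec[OF assms(2) F_in] assms(1,3)
      by (simp_all add: psd_dual psd_proj proj_compl psd_compl_dual_idop)
    moreover have "idop X - dual X F Q = dual X F (idop X - Q) + (idop X - dual X F (idop X))"
      by (simp add: dual_diff)
    ultimately show ?thesis
      using psd_add_app_eq_0_iff[OF assms(1)] app_compl_eq_0_iff[OF assms(1) v_vec]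
        app_ldual_eq_self_iff[OF assms(1) v_vec] by metis
  qed
  then show ?thesis by (auto simp: wp_space_def wlp_space_def fixed_space_def)
qed

section \<open>Weakest preconditions and strongest postconditions\<close>

lemma the_largest_proj:
  assumes "finite Y" "vec.subspace K" "K \<subseteq> vecs Y"
    and sat_iff: "\<And>P. proj Y P \<Longrightarrow> sat P \<longleftrightarrow> rng Y P \<subseteq> K"
    and T_def: "T = (THE P. proj Y P \<and> sat P \<and> (\<forall>P'. proj Y P' \<and> sat P' \<longrightarrow> psub Y P' P))"
  shows "proj Y T \<and> rng Y T = K"
proof -
  obtain P where proj_P: "proj Y P" "rng Y P = K" using ex_proj_rng[OF assms(1-3)] by blast
  have "T = P" unfolding T_def
    using proj_P sat_iff proj_eqI[OF assms(1)] by (intro the_equality) (auto simp: psub_def)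
  then show ?thesis using proj_P by simp
qed

lemma the_least_proj:
  assumes "finite Y" "vec.subspace K" "K \<subseteq> vecs Y"
    and sat_iff: "\<And>P. proj Y P \<Longrightarrow> sat P \<longleftrightarrow> K \<subseteq> rng Y P"
    and T_def: "T = (THE P. proj Y P \<and> sat P \<and> (\<forall>P'. proj Y P' \<and> sat P' \<longrightarrow> psub Y P P'))"
  shows "proj Y T \<and> rng Y T = K"
proof -
  obtain P where proj_P: "proj Y P" "rng Y P = K" using ex_proj_rng[OF assms(1-3)] by blast
  have "T = P" unfolding T_def
    using proj_P sat_iff proj_eqI[OF assms(1)] by (intro the_equality) (auto simp: psub_def)
  then show ?thesis using proj_P by simp
qed

locale nondet_program =
  fixes V :: "nat set" and S :: "sop set"
  assumes finite_V [simp]: "finite V" and NProg_S: "NProg V S"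
begin

abbreviation lift :: "nat set \<Rightarrow> sop set" where
  "lift X \<equiv> sext V X ` S"

lemma S_nonempty: "S \<noteq> {}"
  using NProg_S by (simp add: NProg_def)

lemma DProg_of_mem: "E \<in> S \<Longrightarrow> DProg V E"
  using NProg_S by (simp add: NProg_def)

lemma subchannel_lift: "finite X \<Longrightarrow> V \<subseteq> X \<Longrightarrow> \<forall>F\<in>lift X. subchannel X F"
  by (simp add: subchannel_sext DProg_of_mem)

lemma proj_ext_Un: "finite U \<Longrightarrow> proj U P \<Longrightarrow> proj (V \<union> U) (ext U (V \<union> U) P)"
  by (simp add: proj_ext)

subsection \<open>Correctness as inclusion of subspaces\<close>

lemma sat_tot_iff:
  assumes "finite Y" "Y = V \<union> U1 \<union> U2" "proj U1 P" "proj U2 Q"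
  shows "sat_tot S V U1 P U2 Q \<longleftrightarrow> rng Y (ext U1 Y P) \<subseteq> wp_space Y (lift Y) (ext U2 Y Q)"
proof -
  have subregisters: "V \<subseteq> Y" "U1 \<subseteq> Y" "U2 \<subseteq> Y" using assms(2) by auto
  show ?thesis
    unfolding sat_tot_def wp_space_def image_image assms(2)[symmetric]
  proof (rule density_le_INF_iff[OF assms(1) subregisters(2) S_nonempty assms(3)])
    show "effect Y (dual Y (sext V Y E) (ext U2 Y Q))" if "E \<in> S" for E
      using subregisters assms(1,4) that
      by (intro effect_dual subchannel_sext effect_proj proj_ext DProg_of_mem)
    show "Re (tr X (mult X (ext U2 X Q) (sext V X E \<rho>))) =
        Re (tr X (mult X (ext Y X (dual Y (sext V Y E) (ext U2 Y Q))) \<rho>))"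
      if "finite X" "Y \<subseteq> X" "density X \<rho>" "E \<in> S" for X \<rho> E
      using that subregisters
      by (simp add: ext_ext density_def psd_is_op DProg_of_mem tr_dual linear_sop_sext
          flip: dual_sext_ext)
  qed
qed

lemma sat_par_iff:
  assumes "finite Y" "Y = V \<union> U1 \<union> U2" "proj U1 P" "proj U2 Q"
  shows "sat_par S V U1 P U2 Q \<longleftrightarrow> rng Y (ext U1 Y P) \<subseteq> wlp_space Y (lift Y) (ext U2 Y Q)"
proof -
  have subregisters: "V \<subseteq> Y" "U1 \<subseteq> Y" "U2 \<subseteq> Y" using assms(2) by auto
  show ?thesis
    unfolding sat_par_def wlp_space_def image_image assms(2)[symmetric]
  proof (rule density_le_INF_iff[OF assms(1) subregisters(2) S_nonempty assms(3)])
    show "effect Y (ldual Y (sext V Y E) (ext U2 Y Q))" if "E \<in> S" for E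
      using subregisters assms(1,4) that
      by (intro effect_ldual subchannel_sext effect_proj proj_ext DProg_of_mem)
    show "Re (tr X (mult X (ext U2 X Q) (sext V X E \<rho>))) + Re (tr X \<rho>) - Re (tr X (sext V X E \<rho>)) =
        Re (tr X (mult X (ext Y X (ldual Y (sext V Y E) (ext U2 Y Q))) \<rho>))"
      if "finite X" "Y \<subseteq> X" "density X \<rho>" "E \<in> S" for X \<rho> E
    proof -
      have "ext Y X (ldual Y (sext V Y E) (ext U2 Y Q)) = ldual X (sext V X E) (ext U2 X Q)"
        using that subregisters
        by (simp add: ldual_def ext_diff ext_idop ext_ext DProg_of_mem flip: dual_sext_ext)
      then show ?thesis
        using that by (simp add: tr_ldual linear_sop_sext DProg_of_mem density_def psd_is_op)
    qed
  qed
qed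

lemma
  assumes "finite U" "proj U Q"
  shows proj_wp: "proj (V \<union> U) (wp S V U Q)"
    and rng_wp: "rng (V \<union> U) (wp S V U Q) = wp_space (V \<union> U) (lift (V \<union> U)) (ext U (V \<union> U) Q)"
proof -
  have register: "finite (V \<union> U)" "V \<union> U = V \<union> (V \<union> U) \<union> U" using assms(1) by auto
  have "sat_tot S V (V \<union> U) P U Q \<longleftrightarrow>
      rng (V \<union> U) P \<subseteq> wp_space (V \<union> U) (lift (V \<union> U)) (ext U (V \<union> U) Q)"
    if "proj (V \<union> U) P" for P
    using sat_tot_iff[OF register that assms(2)] that by (simp add: ext_self proj_is_op)
  from the_largest_proj[OF register(1) _ _ this wp_def]
  show "proj (V \<union> U) (wp S V U Q)"
    "rng (V \<union> U) (wp S V U Q) = wp_space (V \<union> U) (lift (V \<union> U)) (ext U (V \<union> U) Q)"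
    unfolding wp_space_def by (simp_all add: subspace_fixed_space fixed_space_subset_vecs)
qed

lemma
  assumes "finite U" "proj U Q"
  shows proj_wlp: "proj (V \<union> U) (wlp S V U Q)"
    and rng_wlp: "rng (V \<union> U) (wlp S V U Q) = wlp_space (V \<union> U) (lift (V \<union> U)) (ext U (V \<union> U) Q)"
proof -
  have register: "finite (V \<union> U)" "V \<union> U = V \<union> (V \<union> U) \<union> U" using assms(1) by auto
  have "sat_par S V (V \<union> U) P U Q \<longleftrightarrow>
      rng (V \<union> U) P \<subseteq> wlp_space (V \<union> U) (lift (V \<union> U)) (ext U (V \<union> U) Q)"
    if "proj (V \<union> U) P" for P
    using sat_par_iff[OF register that assms(2)] that by (simp add: ext_self proj_is_op)
  from the_largest_proj[OF register(1) _ _ this wlp_def]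
  show "proj (V \<union> U) (wlp S V U Q)"
    "rng (V \<union> U) (wlp S V U Q) = wlp_space (V \<union> U) (lift (V \<union> U)) (ext U (V \<union> U) Q)"
    unfolding wlp_space_def by (simp_all add: subspace_fixed_space fixed_space_subset_vecs)
qed

lemma
  assumes "finite U" "proj U P"
  shows proj_sp: "proj (V \<union> U) (sp S V U P)"
    and rng_sp: "rng (V \<union> U) (sp S V U P) = sp_space (V \<union> U) (lift (V \<union> U)) (ext U (V \<union> U) P)"
proof -
  have register: "finite (V \<union> U)" "V \<union> U = V \<union> U \<union> (V \<union> U)" "V \<subseteq> V \<union> U" using assms(1) by auto
  note subchannels = subchannel_lift[OF register(1,3)]
  note proj_ext_P = proj_ext_Un[OF assms]
  have "sat_par S V U P (V \<union> U) R \<longleftrightarrow>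
      sp_space (V \<union> U) (lift (V \<union> U)) (ext U (V \<union> U) P) \<subseteq> rng (V \<union> U) R"
    if proj_R: "proj (V \<union> U) R" for R
    using sat_par_iff[OF register(1,2) assms(2) proj_R]
      sp_space_subset_iff[OF register(1) subchannels proj_ext_P proj_R]
    by (simp add: ext_self proj_is_op proj_R)
  from the_least_proj[OF register(1) _ sp_space_subset_vecs[OF subchannels proj_ext_P] this sp_def]
  show "proj (V \<union> U) (sp S V U P)"
    "rng (V \<union> U) (sp S V U P) = sp_space (V \<union> U) (lift (V \<union> U)) (ext U (V \<union> U) P)"
    by (simp_all add: sp_space_def)
qed

end

context nondet_program
begin

subsection \<open>Duality and lattice laws\<close>

lemma rng_wp_eq_Int:
  assumes "finite U" "proj U Q"
  shows "rng (V \<union> U) (wp S V U Q) = rng (V \<union> U) (wlp S V U Q) \<inter> rng (V \<union> U) (wp S V U (idop U))"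
  using assms wp_space_eq_wlp_space_Int[OF _ subchannel_lift proj_ext_Un[OF assms]]
  by (simp add: rng_wp rng_wlp ext_idop)

lemma wp_eq_pmeet_wlp:
  assumes "finite U" "proj U Q"
  shows "wp S V U Q = pmeet (V \<union> U) (wlp S V U Q) (wp S V U (idop U))"
  using assms
  by (intro proj_eqI[of "V \<union> U"])
    (simp_all add: proj_wp proj_wlp proj_pmeet rng_pmeet rng_wp_eq_Int[of U Q])

lemma wp_0: "finite U \<Longrightarrow> wp S V U 0 = 0"
  using proj_wp[of U 0] rng_wp[of U 0] S_nonempty
  by (intro proj_eqI[of "V \<union> U"]) (simp_all add: wp_space_0)

lemma wlp_idop: "finite U \<Longrightarrow> wlp S V U (idop U) = idop (V \<union> U)"
  using proj_wlp[of U "idop U"] rng_wlp[of U "idop U"]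
  by (intro proj_eqI[of "V \<union> U"]) (simp_all add: ext_idop wlp_space_idop rng_idop)

lemma wlp_ext:
  assumes "finite U" "proj U Q"
  shows "wlp S V (V \<union> U) (ext U (V \<union> U) Q) = wlp S V U Q"
proof (rule proj_eqI)
  show register: "finite (V \<union> U)" using assms(1) by simp
  note proj_ext_Q = proj_ext_Un[OF assms]
  show "proj (V \<union> U) (wlp S V (V \<union> U) (ext U (V \<union> U) Q))"
    using proj_wlp[OF register proj_ext_Q] by simp
  show "proj (V \<union> U) (wlp S V U Q)" by (rule proj_wlp[OF assms])
  show "rng (V \<union> U) (wlp S V (V \<union> U) (ext U (V \<union> U) Q)) = rng (V \<union> U) (wlp S V U Q)"
    using rng_wlp[OF register proj_ext_Q] by (simp add: rng_wlp[OF assms] ext_self)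
qed

lemma sp_psub_iff_psub_wlp:
  assumes "finite U" "proj U P" "proj (V \<union> U) R"
  shows "psub (V \<union> U) (sp S V U P) R \<longleftrightarrow> psub (V \<union> U) (ext U (V \<union> U) P) (wlp S V (V \<union> U) R)"
proof -
  have register: "finite (V \<union> U)" "V \<subseteq> V \<union> U" using assms(1) by auto
  show ?thesis
    using sp_space_subset_iff[OF register(1) subchannel_lift[OF register]
        proj_ext_Un[OF assms(1,2)] assms(3)]
      rng_wlp[OF register(1) assms(3)]
    by (simp add: psub_def rng_sp[OF assms(1,2)] ext_self proj_is_op[OF assms(3)])
qed

lemma sp_wlp_psub:
  assumes "finite U" "proj U Q"
  shows "psub (V \<union> U) (sp S V (V \<union> U) (wlp S V U Q)) (ext U (V \<union> U) Q)"
  using sp_psub_iff_psub_wlp[of "V \<union> U" "wlp S V U Q"] proj_wlp[OF assms]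
    proj_ext_Un[OF assms] assms(1)
  by (simp add: wlp_ext[OF assms] ext_self proj_is_op)

lemma psub_wlp_sp:
  assumes "finite U" "proj U P"
  shows "psub (V \<union> U) (ext U (V \<union> U) P) (wlp S V (V \<union> U) (sp S V U P))"
  using sp_psub_iff_psub_wlp[OF assms proj_sp[OF assms]] by simp

lemma sp_0:
  assumes "finite U"
  shows "sp S V U 0 = 0"
proof (rule psub_antisym)
  show "psub (V \<union> U) (sp S V U 0) 0" using sp_psub_iff_psub_wlp[OF assms, of 0 0] by simp
qed (use assms proj_sp[of U 0] in simp_all)

lemma sp_mono:
  assumes "finite U" "proj U P" "proj U Q" "psub U P Q"
  shows "psub (V \<union> U) (sp S V U P) (sp S V U Q)"
proof -
  have "psub (V \<union> U) (ext U (V \<union> U) P) (ext U (V \<union> U) Q)"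
    using assms by (intro ext_mono) auto
  then show ?thesis
    unfolding sp_psub_iff_psub_wlp[OF assms(1,2) proj_sp[OF assms(1,3)]]
    using psub_wlp_sp[OF assms(1,3)] by (rule psub_trans)
qed

lemma wlp_mono:
  assumes "finite U" "proj U P" "proj U Q" "psub U P Q"
  shows "psub (V \<union> U) (wlp S V U P) (wlp S V U Q)"
  unfolding psub_def rng_wlp[OF assms(1,2)] rng_wlp[OF assms(1,3)]
  using assms by (intro wlp_space_mono subchannel_lift ext_mono proj_ext_Un) auto

lemma wp_mono:
  assumes "finite U" "proj U P" "proj U Q" "psub U P Q"
  shows "psub (V \<union> U) (wp S V U P) (wp S V U Q)"
  using wlp_mono[OF assms]
  unfolding psub_def rng_wp_eq_Int[OF assms(1,2)] rng_wp_eq_Int[OF assms(1,3)] by blast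

lemma rng_wlp_pmeet:
  assumes "finite U" "proj U P" "proj U Q"
  shows "rng (V \<union> U) (wlp S V U (pmeet U P Q)) =
    rng (V \<union> U) (wlp S V U P) \<inter> rng (V \<union> U) (wlp S V U Q)"
  using wlp_space_pmeet[OF _ subchannel_lift proj_ext_Un[OF assms(1,2)]
      proj_ext_Un[OF assms(1,3)]] assms
  by (simp add: rng_wlp proj_pmeet ext_pmeet)

lemma wlp_pmeet:
  assumes "finite U" "proj U P" "proj U Q"
  shows "wlp S V U (pmeet U P Q) = pmeet (V \<union> U) (wlp S V U P) (wlp S V U Q)"
  using assms
  by (intro proj_eqI[of "V \<union> U"]) (simp_all add: proj_wlp proj_pmeet rng_pmeet rng_wlp_pmeet)

lemma wp_pmeet:
  assumes "finite U" "proj U P" "proj U Q"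
  shows "wp S V U (pmeet U P Q) = pmeet (V \<union> U) (wp S V U P) (wp S V U Q)"
proof (rule proj_eqI[of "V \<union> U"])
  have "rng (V \<union> U) (wp S V U (pmeet U P Q)) = rng (V \<union> U) (wp S V U P) \<inter> rng (V \<union> U) (wp S V U Q)"
    unfolding rng_wp_eq_Int[OF assms(1) proj_pmeet[OF assms]] rng_wp_eq_Int[OF assms(1,2)]
      rng_wp_eq_Int[OF assms(1,3)] rng_wlp_pmeet[OF assms] by blast
  then show "rng (V \<union> U) (wp S V U (pmeet U P Q)) =
      rng (V \<union> U) (pmeet (V \<union> U) (wp S V U P) (wp S V U Q))"
    using assms by (simp add: rng_pmeet proj_wp)
qed (use assms in \<open>simp_all add: proj_wp proj_pmeet\<close>)

lemma sp_pmeet_psub: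
  assumes "finite U" "proj U P" "proj U Q"
  shows "psub (V \<union> U) (sp S V U (pmeet U P Q)) (pmeet (V \<union> U) (sp S V U P) (sp S V U Q))"
  using assms psub_pmeet_iff[OF assms, of "pmeet U P Q"]
  by (simp add: psub_pmeet_iff proj_sp sp_mono proj_pmeet)

lemma pjoin_wlp_psub:
  assumes "finite U" "proj U P" "proj U Q"
  shows "psub (V \<union> U) (pjoin (V \<union> U) (wlp S V U P) (wlp S V U Q)) (wlp S V U (pjoin U P Q))"
  using assms pjoin_psub_iff[OF assms, of "pjoin U P Q"]
  by (simp add: pjoin_psub_iff proj_wlp wlp_mono proj_pjoin)

lemma pjoin_wp_psub:
  assumes "finite U" "proj U P" "proj U Q"
  shows "psub (V \<union> U) (pjoin (V \<union> U) (wp S V U P) (wp S V U Q)) (wp S V U (pjoin U P Q))"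
  using assms pjoin_psub_iff[OF assms, of "pjoin U P Q"]
  by (simp add: pjoin_psub_iff proj_wp wp_mono proj_pjoin)

lemma sp_pjoin:
  assumes "finite U" "proj U P" "proj U Q"
  shows "sp S V U (pjoin U P Q) = pjoin (V \<union> U) (sp S V U P) (sp S V U Q)"
proof -
  let ?J = "pjoin (V \<union> U) (sp S V U P) (sp S V U Q)"
  have register: "finite (V \<union> U)" using assms(1) by simp
  have proj_J: "proj (V \<union> U) ?J"
    by (rule proj_pjoin[OF register proj_sp[OF assms(1,2)] proj_sp[OF assms(1,3)]])
  have proj_sp_join: "proj (V \<union> U) (sp S V U (pjoin U P Q))"
    by (rule proj_sp[OF assms(1) proj_pjoin[OF assms]])
  have same_upper_bounds: "psub (V \<union> U) (sp S V U (pjoin U P Q)) R \<longleftrightarrow> psub (V \<union> U) ?J R"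
    if "proj (V \<union> U) R" for R
    using that assms
    by (simp add: sp_psub_iff_psub_wlp ext_pjoin pjoin_psub_iff proj_ext_Un proj_pjoin proj_sp)
  show ?thesis
    using same_upper_bounds[OF proj_sp_join] same_upper_bounds[OF proj_J]
    by (intro psub_antisym[OF register proj_sp_join proj_J]) simp_all
qed

subsection \<open>Tensoring with a projector on a disjoint register\<close>

lemma sext_outer_tensor_vec:
  assumes "E \<in> S" "V \<subseteq> Y" "Y \<inter> Z = {}"
  shows "sext V (Y \<union> Z) E (outer (tensor_vec Y Z v r) (tensor_vec Y Z v r)) =
    tensor Y Z (sext V Y E (outer v v)) (outer r r)"
  using assms by (simp add: outer_tensor_vec sext_tensor DProg_of_mem)

lemma wp_space_tensor:
  assumes "Y \<inter> Z = {}" "finite Y" "finite Z" "V \<subseteq> Y" "proj Z R"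
    and "proj Y N" "rng Y N = wp_space Y (lift Y) Q"
  shows "rng (Y \<union> Z) (tensor Y Z N R) = wp_space (Y \<union> Z) (lift (Y \<union> Z)) (tensor Y Z Q R)"
proof -
  let ?\<M> = "(\<lambda>E. dual Y (sext V Y E) Q) ` S"
  have "rng Y N = fixed_space Y ?\<M>" using assms(7) by (simp add: wp_space_def image_image)
  then have "rng (Y \<union> Z) (tensor Y Z N R) = fixed_space (Y \<union> Z) ((\<lambda>M. tensor Y Z M R) ` ?\<M>)"
    using assms S_nonempty by (intro rng_tensor_fixed_space) auto
  also have "\<dots> = wp_space (Y \<union> Z) (lift (Y \<union> Z)) (tensor Y Z Q R)"
    using assms by (simp add: wp_space_def image_image dual_sext_tensor DProg_of_mem
        cong: image_cong)
  finally show ?thesis .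
qed

lemma wlp_space_tensor_superset:
  assumes "Y \<inter> Z = {}" "finite Y" "finite Z" "V \<subseteq> Y" "proj Y Q" "proj Z R"
    and "rng Y A \<subseteq> wlp_space Y (lift Y) Q"
  shows "rng (Y \<union> Z) (tensor Y Z A R) \<subseteq> wlp_space (Y \<union> Z) (lift (Y \<union> Z)) (tensor Y Z Q R)"
proof (rule rng_tensor_subset[OF assms(1-3)])
  show "vec.subspace (wlp_space (Y \<union> Z) (lift (Y \<union> Z)) (tensor Y Z Q R))"
    by (simp add: wlp_space_def subspace_fixed_space)
next
  fix u r assume u_in: "u \<in> rng Y A" and r_in: "r \<in> rng Z R"
  have union: "finite (Y \<union> Z)" "V \<subseteq> Y \<union> Z" using assms by auto
  have "u \<in> wlp_space Y (lift Y) Q" using u_in assms(7) by blast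
  then have vecs: "is_vec Y u" "is_vec Z r"
    and rng_E_u: "\<forall>E\<in>S. rng Y (sext V Y E (outer u u)) \<subseteq> rng Y Q"
    using r_in
    by (simp_all add: mem_wlp_space_iff[OF assms(2) subchannel_lift[OF assms(2,4)] assms(5)]
        rng_proj[OF assms(6)])
  have "rng (Y \<union> Z) (sext V (Y \<union> Z) E (outer (tensor_vec Y Z u r) (tensor_vec Y Z u r)))
      \<subseteq> rng (Y \<union> Z) (tensor Y Z Q R)" if "E \<in> S" for E
    unfolding sext_outer_tensor_vec[OF that assms(4,1)]
    using that rng_E_u vecs rng_outer_self_subset[OF assms(3,6) r_in] assms
    by (intro rng_tensor_mono) (auto simp: is_op_outer)
  then show "tensor_vec Y Z u r \<in> wlp_space (Y \<union> Z) (lift (Y \<union> Z)) (tensor Y Z Q R)"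
    using mem_wlp_space_iff[OF union(1) subchannel_lift[OF union] proj_tensor[OF assms(1,5,6)]]
    by simp
qed

lemma tensor_vec_in_sp_space:
  assumes "Y \<inter> Z = {}" "finite Z" "V \<subseteq> Y" "proj Z R" "x \<in> sp_space Y (lift Y) A" "r \<in> rng Z R"
  shows "tensor_vec Y Z x r \<in> sp_space (Y \<union> Z) (lift (Y \<union> Z)) (tensor Y Z A R)"
proof -
  let ?K = "sp_space (Y \<union> Z) (lift (Y \<union> Z)) (tensor Y Z A R)"
  have "tensor_vec Y Z w r \<in> ?K"
    if E_in: "E \<in> S" and v_in: "v \<in> rng Y A"
      and w_in: "w \<in> rng Y (sext V Y E (outer v v))" for E v w
  proof -
    have "r \<in> rng Z (outer r r)"
      using assms(4,6) by (intro mem_rng_outer_self[OF assms(2)]) (simp add: rng_proj)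
    then have "tensor_vec Y Z w r
        \<in> rng (Y \<union> Z) (sext V (Y \<union> Z) E (outer (tensor_vec Y Z v r) (tensor_vec Y Z v r)))"
      unfolding sext_outer_tensor_vec[OF E_in assms(3,1)]
      by (rule tensor_vec_in_rng_tensor[OF assms(1) w_in])
    moreover have "tensor_vec Y Z v r \<in> rng (Y \<union> Z) (tensor Y Z A R)"
      by (rule tensor_vec_in_rng_tensor[OF assms(1) v_in assms(6)])
    ultimately show ?thesis
      unfolding sp_space_def using E_in by (intro vec.span_base) blast
  qed
  then have "sp_space Y (lift Y) A \<subseteq> (\<lambda>u. tensor_vec Y Z u r) -` ?K"
    unfolding sp_space_def[of Y]
    by (intro vec.span_minimal tensor_vec.subspace_vimage) (auto simp: sp_space_def)
  then show ?thesis using assms(5) by auto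
qed

lemma sp_space_tensor:
  assumes "Y \<inter> Z = {}" "finite Y" "finite Z" "V \<subseteq> Y" "proj Z R"
    and "proj Y A" "proj Y N" "rng Y N = sp_space Y (lift Y) A"
  shows "rng (Y \<union> Z) (tensor Y Z N R) = sp_space (Y \<union> Z) (lift (Y \<union> Z)) (tensor Y Z A R)"
proof
  show "rng (Y \<union> Z) (tensor Y Z N R) \<subseteq> sp_space (Y \<union> Z) (lift (Y \<union> Z)) (tensor Y Z A R)"
    using tensor_vec_in_sp_space[OF assms(1,3,4,5)] assms(8)
    by (intro rng_tensor_subset[OF assms(1-3)]) (simp_all add: sp_space_def)
  have union: "finite (Y \<union> Z)" "V \<subseteq> Y \<union> Z" using assms by auto
  have "rng Y A \<subseteq> wlp_space Y (lift Y) N"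
    using sp_space_subset_iff[OF assms(2) subchannel_lift[OF assms(2,4)] assms(6,7)] assms(8)
    by simp
  then have "rng (Y \<union> Z) (tensor Y Z A R) \<subseteq> wlp_space (Y \<union> Z) (lift (Y \<union> Z)) (tensor Y Z N R)"
    by (rule wlp_space_tensor_superset[OF assms(1-4,7,5)])
  then show "sp_space (Y \<union> Z) (lift (Y \<union> Z)) (tensor Y Z A R) \<subseteq> rng (Y \<union> Z) (tensor Y Z N R)"
    using sp_space_subset_iff[OF union(1) subchannel_lift[OF union]
        proj_tensor[OF assms(1,6,5)] proj_tensor[OF assms(1,7,5)]] by simp
qed

context
  fixes U Z :: "nat set" and R :: op
  assumes registers: "finite U" "finite Z" "Z \<inter> (V \<union> U) = {}" and proj_R: "proj Z R"
begin

lemma finite_registers: "finite (V \<union> U)" "finite (U \<union> Z)" "finite (V \<union> U \<union> Z)"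
  using registers by auto

lemma disjoint_registers: "U \<inter> Z = {}" "(V \<union> U) \<inter> Z = {}"
  using registers(3) by auto

lemma union_registers: "V \<union> (U \<union> Z) = V \<union> U \<union> Z"
  by blast

lemma ext_tensor_register:
  "ext (U \<union> Z) (V \<union> U \<union> Z) (tensor U Z A R) = tensor (V \<union> U) Z (ext U (V \<union> U) A) R"
  using disjoint_registers by (intro ext_tensor) auto

lemma wp_tensor:
  assumes "proj U Q"
  shows "wp S V (U \<union> Z) (tensor U Z Q R) = tensor (V \<union> U) Z (wp S V U Q) R"
proof (rule proj_eqI[OF finite_registers(3)])
  note tensor_Q = finite_registers(2) proj_tensor[OF disjoint_registers(1) assms proj_R]
  note wp_Q = proj_wp[OF registers(1) assms] rng_wp[OF registers(1) assms]
  show "proj (V \<union> U \<union> Z) (wp S V (U \<union> Z) (tensor U Z Q R))"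
    using proj_wp[OF tensor_Q] by (simp only: union_registers)
  show "proj (V \<union> U \<union> Z) (tensor (V \<union> U) Z (wp S V U Q) R)"
    by (rule proj_tensor[OF disjoint_registers(2) wp_Q(1) proj_R])
  show "rng (V \<union> U \<union> Z) (wp S V (U \<union> Z) (tensor U Z Q R)) =
      rng (V \<union> U \<union> Z) (tensor (V \<union> U) Z (wp S V U Q) R)"
    using rng_wp[OF tensor_Q]
      wp_space_tensor[OF disjoint_registers(2) finite_registers(1) registers(2) Un_upper1
        proj_R wp_Q]
    by (simp only: union_registers ext_tensor_register)
qed

lemma sp_tensor:
  assumes "proj U P"
  shows "sp S V (U \<union> Z) (tensor U Z P R) = tensor (V \<union> U) Z (sp S V U P) R"
proof (rule proj_eqI[OF finite_registers(3)])
  note tensor_P = finite_registers(2) proj_tensor[OF disjoint_registers(1) assms proj_R]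
  note sp_P = proj_sp[OF registers(1) assms] rng_sp[OF registers(1) assms]
  show "proj (V \<union> U \<union> Z) (sp S V (U \<union> Z) (tensor U Z P R))"
    using proj_sp[OF tensor_P] by (simp only: union_registers)
  show "proj (V \<union> U \<union> Z) (tensor (V \<union> U) Z (sp S V U P) R)"
    by (rule proj_tensor[OF disjoint_registers(2) sp_P(1) proj_R])
  show "rng (V \<union> U \<union> Z) (sp S V (U \<union> Z) (tensor U Z P R)) =
      rng (V \<union> U \<union> Z) (tensor (V \<union> U) Z (sp S V U P) R)"
    using rng_sp[OF tensor_P] sp_space_tensor[OF disjoint_registers(2) finite_registers(1)
        registers(2) Un_upper1 proj_R proj_ext_Un[OF registers(1) assms] sp_P]
    by (simp only: union_registers ext_tensor_register)
qed

lemma tensor_wlp_psub: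
  assumes "proj U Q"
  shows "psub (V \<union> U \<union> Z) (tensor (V \<union> U) Z (wlp S V U Q) R) (wlp S V (U \<union> Z) (tensor U Z Q R))"
proof -
  note tensor_Q = finite_registers(2) proj_tensor[OF disjoint_registers(1) assms proj_R]
  have "rng (V \<union> U \<union> Z) (wlp S V (U \<union> Z) (tensor U Z Q R)) =
      wlp_space (V \<union> U \<union> Z) (lift (V \<union> U \<union> Z)) (tensor (V \<union> U) Z (ext U (V \<union> U) Q) R)"
    using rng_wlp[OF tensor_Q] by (simp only: union_registers ext_tensor_register)
  then show ?thesis
    unfolding psub_def using registers(1,2) disjoint_registers(2) assms proj_R
    by (simp add: wlp_space_tensor_superset proj_ext_Un rng_wlp)
qed

end

end

theorem theorem5p6:
  fixes V W :: "nat set" and S :: "sop set" and P Q :: op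
  assumes "finite V" and "NProg V S" and "finite W"
    and "proj W P" and "proj W Q"
  shows
    \<comment> \<open>(1)\<close>
    "psub (V \<union> W) (sp S V (V \<union> W) (wlp S V W Q)) (ext W (V \<union> W) Q)
     \<and> psub (V \<union> W) (ext W (V \<union> W) P) (wlp S V (V \<union> W) (sp S V W P))
    \<comment> \<open>(2)\<close>
     \<and> wp S V W Q = pmeet (V \<union> W) (wlp S V W Q) (wp S V W (idop W))
    \<comment> \<open>(3)\<close>
     \<and> wp S V W zop = zop \<and> sp S V W zop = zop
     \<and> wlp S V W (idop W) = ext W (V \<union> W) (idop W)
    \<comment> \<open>(4)\<close>
     \<and> (psub W P Q \<longrightarrow>
          (\<forall>xp \<in> {wp S V, wlp S V}. psub (V \<union> W) (xp W P) (xp W Q))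
          \<and> psub (V \<union> W) (sp S V W P) (sp S V W Q))
    \<comment> \<open>(5)\<close>
     \<and> (\<forall>xp \<in> {wp S V, wlp S V}.
          xp W (pmeet W P Q) = pmeet (V \<union> W) (xp W P) (xp W Q))
    \<comment> \<open>(6)\<close>
     \<and> psub (V \<union> W) (sp S V W (pmeet W P Q)) (pmeet (V \<union> W) (sp S V W P) (sp S V W Q))
    \<comment> \<open>(7)\<close>
     \<and> (\<forall>xp \<in> {wp S V, wlp S V}.
          psub (V \<union> W) (pjoin (V \<union> W) (xp W P) (xp W Q)) (xp W (pjoin W P Q)))
    \<comment> \<open>(8)\<close>
     \<and> pjoin (V \<union> W) (sp S V W P) (sp S V W Q) = sp S V W (pjoin W P Q)
    \<comment> \<open>(9)\<close>
     \<and> (\<forall>W' R. finite W' \<and> W' \<inter> (V \<union> W) = {} \<and> proj W' R \<longrightarrow>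
          wp S V (W \<union> W') (tensor W W' Q R) = tensor (V \<union> W) W' (wp S V W Q) R
          \<and> sp S V (W \<union> W') (tensor W W' P R) = tensor (V \<union> W) W' (sp S V W P) R
          \<and> psub (V \<union> W \<union> W') (tensor (V \<union> W) W' (wlp S V W Q) R)
                               (wlp S V (W \<union> W') (tensor W W' Q R)))"
proof -
  interpret nondet_program V S using assms(1,2) by unfold_locales
  note W_P_Q = assms(3-5)
  have tensor_laws: "wp S V (W \<union> Z) (tensor W Z Q R) = tensor (V \<union> W) Z (wp S V W Q) R
      \<and> sp S V (W \<union> Z) (tensor W Z P R) = tensor (V \<union> W) Z (sp S V W P) R
      \<and> psub (V \<union> W \<union> Z) (tensor (V \<union> W) Z (wlp S V W Q) R) (wlp S V (W \<union> Z) (tensor W Z Q R))"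
    if "finite Z" "Z \<inter> (V \<union> W) = {}" "proj Z R" for Z R
    using that W_P_Q by (simp add: wp_tensor sp_tensor tensor_wlp_psub)
  have ext_idop_eq: "ext W (V \<union> W) (idop W) = idop (V \<union> W)" by (simp add: ext_idop)
  show ?thesis
    unfolding zop_eq_0 ext_idop_eq
    using sp_wlp_psub[OF W_P_Q(1,3)] psub_wlp_sp[OF W_P_Q(1,2)] wp_eq_pmeet_wlp[OF W_P_Q(1,3)]
      wp_0[OF W_P_Q(1)] sp_0[OF W_P_Q(1)] wlp_idop[OF W_P_Q(1)]
      wp_mono[OF W_P_Q] wlp_mono[OF W_P_Q] sp_mono[OF W_P_Q] wp_pmeet[OF W_P_Q] wlp_pmeet[OF W_P_Q]
      sp_pmeet_psub[OF W_P_Q] pjoin_wp_psub[OF W_P_Q] pjoin_wlp_psub[OF W_P_Q]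
      sp_pjoin[OF W_P_Q] tensor_laws
    by (intro conjI ballI impI allI) auto
qed

end
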